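(* The level-1 consensus detection algorithm LC described in the context checks whether a profile $\pi$ of $n$ preferences on $K$ alternatives exhibits level-1 consensus (it returns a preference $\succ_0$ around which $\pi$ exhibits level-1 consensus if such a preference exists, and otherwise returns "no consensus"), and it does so in time $$O\left(n'^2 K\sqrt{\log K} + n'^2 \log n'\right),\qquad\text{where } n'=\min(K!,n).$$ In particular, the run-time is polynomial in the profile size.
   Context: Let $A=\{a_1,\dots,a_K\}$ be a set of $K\ge 3$ alternatives and let $\mathcal{P}$ be the set of all $K!$ strict total orders on $A$, called preferences. A profile $\pi=(\succ_1,\dots,\succ_n)\in\mathcal{P}^n$ is a list of $n$ preferences (one per voter, possibly with duplicates). The frequency of $\succ\in\mathcal{P}$ is $\mu_\pi(\succ)=|\{i:\succ_i=\succ\}|$. The inversion distance $d(\succ,\succ')$ is the number of two-element subsets $\{a,b\}\subseteq A$ that are ranked differently by $\succ$ and $\succ'$. The profile $\pi$ exhibits level-1 consensus around $\succ_0\in\mathcal{P}$ if both of the following hold: (1) for all $\succ,\succ'\in\mathcal{P}$, $d(\succ,\succ_0)\le d(\succ',\succ_0)$ implies $\mu_\pi(\succ)\ge\mu_\pi(\succ')$; (2) there is at least one pair $\succ,\succ'\in\mathcal{P}$ with $d(\succ,\succ_0)<d(\succ',\succ_0)$ and $\mu_\pi(\succ)>\mu_\pi(\succ')$. The profile exhibits level-1 consensus if it does so around some $\succ_0$. The two conditions together are equivalent to the following two. Condition 1: for all $\succ,\succ'\in\mathcal{P}$, if $\mu_\pi(\succ')>\mu_\pi(\succ)$ then $d(\succ',\succ_0)<d(\succ,\succ_0)$.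 Condition 2: there exist $\succ,\succ'\in\mathcal{P}$ with $\mu_\pi(\succ')>\mu_\pi(\succ)$. Let $T(K,j)$ be the set of permutations of $K$ elements with exactly $j$ inversions. Algorithm LC. Input: the set $A$ and the profile $\pi$ (a list of $n$ preferences, possibly with duplicates). 1. Calculate the frequency $\mu_\pi(\succ)$ of each preference $\succ$ occurring in $\pi$. 2. Let $\ell$ be the number of distinct preferences in $\pi$ (so $\ell\le\min(K!,n)$). 3. If all frequencies are equal and $\ell=K!$, return "no consensus" (Condition 2 is violated). 4. Order the distinct preferences by descending frequency and rename them so that $\mu_\pi(\succ_1)\ge\mu_\pi(\succ_2)\ge\cdots\ge\mu_\pi(\succ_\ell)$. 5. Set $M:=\mu_\pi(\succ_1)$, the maximum frequency. 6. For $j=1,2,\dots,\ell$, while $\mu_\pi(\succ_j)=M$: run the subroutine below on $\pi$ with candidate $\succ_j$; if it returns True, return $\succ_j$. 7. Return "no consensus" (Condition 1 is violated for all candidates). Subroutine (checks Condition 1 for a profile $\pi$ and a candidate preference $\succ_0$): (i) Keeping the order by descending frequency, order the preferences within every group of equal frequency by ascending inversion distance from $\succ_0$; call the resulting list $\succ_1,\dots,\succ_\ell$. (ii) For $i=1,\dots,\ell-1$: if $\mu_\pi(\succ_i)>\mu_\pi(\succ_{i+1})$ and $d(\succ_i,\succ_0)\ge d(\succ_{i+1},\succ_0)$, return False. (iii) Set $\widehat d:=d(\succ_\ell,\succ_0)$. If $\sum_{j=0}^{\widehat d}|T(K,j)|=\ell$, return True; otherwise return False. The inversion distance between two given preferences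 is computed by a known algorithm with run-time $O(K\sqrt{\log K})$.
   Formalization: Reading all n preferences in step 1 cannot fit a bound in n'=min(K!,n) when K is fixed and n grows; so the bound is stated for steps 2–7 for all n≥1, and for all of LC, step 1 included, when n≤K!; total time is shown polynomial in nK for all n≥1. *)

theory Defs
  imports
    Complex_Main
    "HOL-Library.Monad_Syntax"
    "HOL-Combinatorics.Multiset_Permutations"
    "HOL-Computational_Algebra.Polynomial"
begin

section \<open>Preferences and level-1 consensus\<close>

text \<open>A preference is a strict total order on \<open>A\<close>, and \<open>(a, b) \<in> r\<close> means that \<open>a\<close> is preferred
  to \<open>b\<close>.  A profile is a list of preferences; the frequency of \<open>r\<close> in \<open>\<pi>\<close> is \<open>count_list \<pi> r\<close>.\<close>

definition prefs :: "'a set \<Rightarrow> 'a rel set" where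
  "prefs A = {r. r \<subseteq> A \<times> A \<and> strict_linear_order_on A r}"

definition inv_dist :: "'a set \<Rightarrow> 'a rel \<Rightarrow> 'a rel \<Rightarrow> nat" where
  "inv_dist A r s =
     card {X. \<exists>a\<in>A. \<exists>b\<in>A. a \<noteq> b \<and> X = {a, b} \<and> (a, b) \<in> r \<and> (b, a) \<in> s}"

definition level1_around :: "'a set \<Rightarrow> 'a rel list \<Rightarrow> 'a rel \<Rightarrow> bool" where
  "level1_around A \<pi> r0 \<longleftrightarrow> r0 \<in> prefs A \<and>
     (\<forall>r\<in>prefs A. \<forall>s\<in>prefs A. inv_dist A r r0 \<le> inv_dist A s r0 \<longrightarrow>
        count_list \<pi> r \<ge> count_list \<pi> s) \<and>
     (\<exists>r\<in>prefs A. \<exists>s\<in>prefs A. inv_dist A r r0 < inv_dist A s r0 \<and>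
        count_list \<pi> r > count_list \<pi> s)"

definition level1 :: "'a set \<Rightarrow> 'a rel list \<Rightarrow> bool" where
  "level1 A \<pi> \<longleftrightarrow> (\<exists>r0. level1_around A \<pi> r0)"

definition inversions :: "nat list \<Rightarrow> nat" where
  "inversions xs = card {(i, k). i < k \<and> k < length xs \<and> xs ! k < xs ! i}"

text \<open>The set \<open>T(K, j)\<close> of permutations with exactly \<open>j\<close> inversions, in one-line notation.\<close>

definition inv_perms :: "nat \<Rightarrow> nat \<Rightarrow> nat list set" where
  "inv_perms K j = {xs \<in> permutations_of_set {..<K}. inversions xs = j}"


section \<open>Computations with running time\<close>

text \<open>A computation carries its result and the number of steps it takes.  Each call of a
  function below, recursive calls included, costs one \<open>step\<close>; arithmetic operations, comparisons
  of numbers and list constructors are thereby unit-cost.  The inversion distance is computed by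
  an externally given procedure, which is charged its own time.\<close>

datatype 'b tm = TM (val: 'b) (time: nat)

definition bind_tm :: "'b tm \<Rightarrow> ('b \<Rightarrow> 'c tm) \<Rightarrow> 'c tm" where
  "bind_tm m f = TM (val (f (val m))) (time m + time (f (val m)))"

definition return :: "'b \<Rightarrow> 'b tm" where
  "return x = TM x 0"

definition step :: "unit tm" where
  "step = TM () 1"

adhoc_overloading Monad_Syntax.bind \<rightleftharpoons> bind_tm

lemma val_simps [simp]:
  "val (bind_tm m f) = val (f (val m))" "val (return x) = x" "val step = ()"
  by (simp_all add: bind_tm_def return_def)

lemma time_simps [simp]:
  "time (bind_tm m f) = time m + time (f (val m))" "time (return x) = 0" "time step = 1"
  by (simp_all add: bind_tm_def return_def step_def)

lemma bind_tm_cong [fundef_cong]: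
  assumes "m = m'" and "\<And>x. x = val m' \<Longrightarrow> f x = g x"
  shows "bind_tm m f = bind_tm m' g"
  using assms by (simp add: bind_tm_def)


section \<open>Merge sort\<close>

fun halve :: "'b list \<Rightarrow> ('b list \<times> 'b list) tm" where
  "halve [] = do { step; return ([], []) }"
| "halve [x] = do { step; return ([x], []) }"
| "halve (x # y # zs) = do { step; (us, vs) \<leftarrow> halve zs; return (x # us, y # vs) }"

fun merge :: "('b \<Rightarrow> 'b \<Rightarrow> bool) \<Rightarrow> 'b list \<Rightarrow> 'b list \<Rightarrow> 'b list tm" where
  "merge le [] ys = do { step; return ys }"
| "merge le (x # xs) [] = do { step; return (x # xs) }"
| "merge le (x # xs) (y # ys) = do {
     step;
     if le x y then do { zs \<leftarrow> merge le xs (y # ys); return (x # zs) }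
     else do { zs \<leftarrow> merge le (x # xs) ys; return (y # zs) } }"

lemma length_halve:
  "val (halve xs) = (us, vs) \<Longrightarrow>
     length us = (length xs + 1) div 2 \<and> length vs = length xs div 2"
  by (induction xs arbitrary: us vs rule: halve.induct) (auto split: prod.splits)

function msort :: "('b \<Rightarrow> 'b \<Rightarrow> bool) \<Rightarrow> 'b list \<Rightarrow> 'b list tm" where
  "msort le [] = do { step; return [] }"
| "msort le [x] = do { step; return [x] }"
| "msort le (x # y # zs) = do {
     step;
     (us, vs) \<leftarrow> halve (x # y # zs);
     us' \<leftarrow> msort le us;
     vs' \<leftarrow> msort le vs;
     merge le us' vs' }"
  by pat_completeness auto
termination
  by (relation "Wellfounded.measure (\<lambda>(le, xs). length xs)")
    (auto simp del: halve.simps dest!: length_halve[OF sym])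


section \<open>Counting permutations by inversions\<close>

text \<open>\<open>layers K m\<close> computes the numbers \<open>card (inv_perms K 0), \<dots>, card (inv_perms K m)\<close>, the first coefficients
  of \<open>\<Prod>k<K. (1 + x + \<dots> + x ^ k)\<close>.  Each factor is applied by taking differences of prefix sums:
  \<open>lagdiff k ps ps\<close> subtracts from each entry of \<open>ps\<close> the entry \<open>k\<close> places earlier, if any.\<close>

fun zeros :: "nat \<Rightarrow> nat list tm" where
  "zeros 0 = do { step; return [] }"
| "zeros (Suc m) = do { step; xs \<leftarrow> zeros m; return (0 # xs) }"

fun psums :: "nat \<Rightarrow> nat list \<Rightarrow> nat list tm" where
  "psums a [] = do { step; return [] }"
| "psums a (x # xs) = do { step; ys \<leftarrow> psums (a + x) xs; return ((a + x) # ys) }"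

fun lagdiff :: "nat \<Rightarrow> nat list \<Rightarrow> nat list \<Rightarrow> nat list tm" where
  "lagdiff (Suc k) (p # ps) qs = do { step; xs \<leftarrow> lagdiff k ps qs; return (p # xs) }"
| "lagdiff 0 (p # ps) (q # qs) = do { step; xs \<leftarrow> lagdiff 0 ps qs; return ((p - q) # xs) }"
| "lagdiff _ _ _ = do { step; return [] }"

fun layers :: "nat \<Rightarrow> nat \<Rightarrow> nat list tm" where
  "layers 0 m = do { step; xs \<leftarrow> zeros m; return (1 # xs) }"
| "layers (Suc K) m = do {
     step;
     xs \<leftarrow> layers K m;
     ps \<leftarrow> psums 0 xs;
     lagdiff (Suc K) ps ps }"

fun total :: "nat list \<Rightarrow> nat tm" where
  "total [] = do { step; return 0 }"
| "total (x # xs) = do { step; s \<leftarrow> total xs; return (x + s) }"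

text \<open>The test \<open>(\<Sum>j = 0..d. card (inv_perms K j)) = l\<close>, where \<open>d \<le> K choose 2\<close>, as is
  any inversion distance.  All the summands are then positive, so the sum exceeds \<open>l\<close> if
  \<open>d \<ge> l\<close>, and need not be computed.\<close>

definition ball_test :: "nat \<Rightarrow> nat \<Rightarrow> nat \<Rightarrow> bool tm" where
  "ball_test K d l = do {
     step;
     if d \<ge> l then return False
     else do { xs \<leftarrow> layers K d; s \<leftarrow> total xs; return (s = l) } }"

primrec mahonian :: "nat \<Rightarrow> nat \<Rightarrow> nat" where
  "mahonian 0 j = of_bool (j = 0)"
| "mahonian (Suc K) j = (\<Sum>i\<le>K. if i \<le> j then mahonian K (j - i) else 0)"

lemma inversions_Nil: "inversions [] = 0"
  by (simp add: inversions_def)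

lemma inversions_Cons:
  assumes "distinct xs"
  shows "inversions (x # xs) = card {y \<in> set xs. y < x} + inversions xs"
proof -
  let ?S = "{(i, k). i < k \<and> k < length xs \<and> xs ! k < xs ! i}"
  let ?P = "{k. k < length xs \<and> xs ! k < x}"
  have split: "{(i, k). i < k \<and> k < length (x # xs) \<and> (x # xs) ! k < (x # xs) ! i} =
      (\<lambda>k. (0, Suc k)) ` ?P \<union> (\<lambda>(i, k). (Suc i, Suc k)) ` ?S" (is "?L = ?R")
  proof (intro set_eqI iffI)
    fix q assume "q \<in> ?L"
    then obtain i k where q: "q = (i, k)" "i < k" "k < length (x # xs)"
      "(x # xs) ! k < (x # xs) ! i" by auto
    then obtain k' where k': "k = Suc k'" by (cases k) auto
    show "q \<in> ?R"
      using q k' by (cases i) (auto simp: image_iff)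
  next
    fix q assume "q \<in> ?R"
    then show "q \<in> ?L" by auto
  qed
  have fin: "finite ?S"
    by (rule finite_subset[of _ "{..<length xs} \<times> {..<length xs}"]) auto
  have "inversions (x # xs) = card ((\<lambda>k. (0::nat, Suc k)) ` ?P) + card ((\<lambda>(i, k). (Suc i, Suc k)) ` ?S)"
    unfolding inversions_def split using fin by (subst card_Un_disjoint) auto
  also have "card ((\<lambda>k. (0::nat, Suc k)) ` ?P) = card ?P"
    by (rule card_image) (auto simp: inj_on_def)
  also have "card ((\<lambda>(i, k). (Suc i, Suc k)) ` ?S) = card ?S"
    by (rule card_image) (auto simp: inj_on_def)
  also have "card ?P = card ((!) xs ` ?P)"
    by (rule card_image[symmetric]) (use assms in \<open>auto simp: inj_on_def nth_eq_iff_index_eq\<close>)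
  also have "(!) xs ` ?P = {y \<in> set xs. y < x}"
    by (auto simp: in_set_conv_nth)
  finally show ?thesis by (simp add: inversions_def)
qed

lemma rank_bij:
  assumes "finite (S :: nat set)"
  shows "bij_betw (\<lambda>x. card {y \<in> S. y < x}) S {..<card S}"
proof -
  have less: "card {y \<in> S. y < x} < card {y \<in> S. y < z}" if "x \<in> S" "x < z" for x z
  proof (rule psubset_card_mono)
    show "{y \<in> S. y < x} \<subset> {y \<in> S. y < z}"
      using that by (auto intro: less_trans)
  qed (use assms in simp)
  have inj: "inj_on (\<lambda>x. card {y \<in> S. y < x}) S"
  proof (rule inj_onI)
    fix x z assume "x \<in> S" "z \<in> S" "card {y \<in> S. y < x} = card {y \<in> S. y < z}"
    with less[of x z] less[of z x] show "x = z"
      by (cases x z rule: linorder_cases) auto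
  qed
  have "card {y \<in> S. y < x} < card S" if "x \<in> S" for x
    using that assms by (intro psubset_card_mono) blast+
  then have "(\<lambda>x. card {y \<in> S. y < x}) ` S \<subseteq> {..<card S}"
    by blast
  with inj show ?thesis
    by (simp add: bij_betw_def card_image card_subset_eq)
qed

lemma card_inversions_eq:
  assumes "finite S"
  shows "card {xs \<in> permutations_of_set S. inversions xs = j} = mahonian (card S) j"
  using assms
proof (induction "card S" arbitrary: S j)
  case 0
  then have "{xs \<in> permutations_of_set S. inversions xs = j} = (if j = 0 then {[]} else {})"
    by (auto simp: inversions_Nil)
  with 0 show ?case by (simp add: card_0_eq flip: 0(1))
next
  case (Suc K)
  let ?rank = "\<lambda>x. card {y \<in> S. y < x}"
  let ?Q = "\<lambda>x. {xs \<in> permutations_of_set (S - {x}). ?rank x + inversions xs = j}"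
  have ne: "S \<noteq> {}" using Suc by auto
  have inv: "inversions (x # xs) = ?rank x + inversions xs"
    if "x \<in> S" "xs \<in> permutations_of_set (S - {x})" for x xs
  proof -
    have "{y \<in> set xs. y < x} = {y \<in> S. y < x}" "distinct xs"
      using that by (auto simp: permutations_of_set_def)
    then show ?thesis by (simp add: inversions_Cons)
  qed
  have "{xs \<in> permutations_of_set S. inversions xs = j} = (\<Union>x\<in>S. (#) x ` ?Q x)"
    unfolding permutations_of_set_nonempty[OF ne] using inv by auto
  also have "card \<dots> = (\<Sum>x\<in>S. card ((#) x ` ?Q x))"
    by (rule card_UN_disjoint) (use Suc in auto)
  also have "\<dots> = (\<Sum>x\<in>S. if ?rank x \<le> j then mahonian K (j - ?rank x) else 0)"
  proof (rule sum.cong[OF refl])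
    fix x assume x: "x \<in> S"
    have Q: "?Q x = (if ?rank x \<le> j
        then {xs \<in> permutations_of_set (S - {x}). inversions xs = j - ?rank x} else {})"
      by auto
    have "card ((#) x ` ?Q x) = card (?Q x)"
      by (rule card_image) auto
    also have "\<dots> = (if ?rank x \<le> j then mahonian K (j - ?rank x) else 0)"
    proof -
      have "K = card (S - {x})" using Suc.hyps(2) Suc.prems x by simp
      from Suc.hyps(1)[OF this] show ?thesis
        unfolding Q using Suc.prems \<open>K = card (S - {x})\<close>[symmetric] by simp
    qed
    finally show "card ((#) x ` ?Q x) = \<dots>" .
  qed
  also have "\<dots> = (\<Sum>i\<in>{..<card S}. if i \<le> j then mahonian K (j - i) else 0)"
    using sum.reindex_bij_betw[OF rank_bij[OF Suc.prems]] by fast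
  also have "\<dots> = mahonian (card S) j"
    by (simp add: lessThan_Suc_atMost flip: Suc.hyps(2))
  finally show ?case .
qed

lemma card_inv_perms: "card (inv_perms K j) = mahonian K j"
  using card_inversions_eq[of "{..<K}" j] by (simp add: inv_perms_def)

lemma val_zeros: "val (zeros m) = replicate m 0"
  by (induction m) auto

lemma val_psums: "val (psums a xs) = map (\<lambda>j. a + sum ((!) xs) {..j}) [0..<length xs]"
proof (induction xs arbitrary: a)
  case (Cons x xs)
  have "sum ((!) (x # xs)) {..Suc j} = x + sum ((!) xs) {..j}" for j
    by (subst sum.atMost_Suc_shift) simp
  with Cons show ?case by (simp add: upt_conv_Cons map_Suc_upt[symmetric] del: upt_Suc)
qed simp

lemma length_lagdiff:
  "k + length qs \<ge> length ps \<Longrightarrow> length (val (lagdiff k ps qs)) = length ps"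
  by (induction k ps qs rule: lagdiff.induct) auto

lemma nth_lagdiff:
  "k + length qs \<ge> length ps \<Longrightarrow> i < length ps \<Longrightarrow>
     val (lagdiff k ps qs) ! i = (if i < k then ps ! i else ps ! i - qs ! (i - k))"
  by (induction k ps qs arbitrary: i rule: lagdiff.induct) (auto simp: nth_Cons split: nat.splits)

lemma val_layers_mahonian: "val (layers K m) = map (mahonian K) [0..<Suc m]"
proof (induction K)
  case 0
  show ?case by (rule nth_equalityI) (auto simp: val_zeros nth_Cons simp del: upt_Suc split: nat.splits)
next
  case (Suc K)
  define ps where "ps = map (\<lambda>j. \<Sum>i\<le>j. mahonian K i) [0..<Suc m]"
  have ps: "val (psums 0 (map (mahonian K) [0..<Suc m])) = ps"
    unfolding val_psums ps_def by (auto simp del: upt_Suc intro!: sum.cong)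
  have rec: "mahonian (Suc K) j =
      (if j < Suc K then \<Sum>i\<le>j. mahonian K i
       else (\<Sum>i\<le>j. mahonian K i) - (\<Sum>i\<le>j - Suc K. mahonian K i))" for j
  proof -
    have "mahonian (Suc K) j = (\<Sum>i | i \<le> K \<and> i \<le> j. mahonian K (j - i))"
      unfolding mahonian.simps by (subst sum.inter_filter[symmetric]) (auto simp: Collect_conj_eq)
    also have "\<dots> = (\<Sum>i | i \<le> j \<and> j \<le> i + K. mahonian K i)"
      by (rule sum.reindex_bij_witness[of _ "\<lambda>i. j - i" "\<lambda>i. j - i"]) auto
    finally have eq: "mahonian (Suc K) j = (\<Sum>i | i \<le> j \<and> j \<le> i + K. mahonian K i)" .
    show ?thesis
    proof (cases "j < Suc K")
      case True
      then have "{i. i \<le> j \<and> j \<le> i + K} = {..j}" by auto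
      with eq True show ?thesis by simp
    next
      case False
      then have "{i. i \<le> j \<and> j \<le> i + K} = {..j} - {..j - Suc K}" by auto
      with eq False show ?thesis by (simp add: sum_diff_nat del: mahonian.simps)
    qed
  qed
  show ?case
  proof (rule nth_equalityI)
    show "length (val (layers (Suc K) m)) = length (map (mahonian (Suc K)) [0..<Suc m])"
      by (simp add: Suc ps length_lagdiff del: upt_Suc) (simp add: ps_def)
    fix i assume "i < length (val (layers (Suc K) m))"
    then have i: "i < Suc m"
      by (simp add: Suc ps length_lagdiff del: upt_Suc) (simp add: ps_def)
    have "val (layers (Suc K) m) ! i = (if i < Suc K then ps ! i else ps ! i - ps ! (i - Suc K))"
    proof -
      have "val (layers (Suc K) m) = val (lagdiff (Suc K) ps ps)"
        by (simp add: Suc ps del: upt_Suc lagdiff.simps)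
      moreover have "i < length ps" using i by (simp add: ps_def del: upt_Suc)
      ultimately show ?thesis by (simp only: nth_lagdiff le_add2)
    qed
    also have "\<dots> = mahonian (Suc K) i"
      unfolding rec using i by (auto simp: ps_def simp del: upt_Suc mahonian.simps)
    finally show "val (layers (Suc K) m) ! i = map (mahonian (Suc K)) [0..<Suc m] ! i"
      using i by (simp del: upt_Suc mahonian.simps)
  qed
qed

lemma val_layers: "val (layers K m) = map (\<lambda>j. card (inv_perms K j)) [0..<Suc m]"
  by (simp add: card_inv_perms val_layers_mahonian del: upt_Suc)

lemma val_total: "val (total xs) = sum_list xs"
  by (induction xs) auto

lemma mahonian_pos: "j \<le> K choose 2 \<Longrightarrow> mahonian K j > 0"
proof (induction K arbitrary: j)
  case 0
  then show ?case by (simp add: binomial_eq_0)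
next
  case (Suc K)
  define i where "i = min K j"
  have "Suc K choose 2 = K + (K choose 2)" by (simp add: numeral_2_eq_2)
  with Suc.prems have "j - i \<le> K choose 2" by (auto simp: i_def min_def)
  then have "mahonian K (j - i) > 0" by (rule Suc.IH)
  moreover have "i \<le> K" "i \<le> j" by (auto simp: i_def)
  ultimately show ?case by (auto simp: sum_pos2[of _ i] intro!: sum_pos2[of _ i])
qed

text \<open>The result of the test is the intended one.\<close>

lemma val_ball_test:
  assumes "d \<le> K choose 2"
  shows "val (ball_test K d l) \<longleftrightarrow> (\<Sum>j=0..d. card (inv_perms K j)) = l"
proof -
  have "(\<Sum>j=0..d. 1) \<le> (\<Sum>j=0..d. card (inv_perms K j))"
  proof (rule sum_mono)
    fix j assume "j \<in> {0..d}"
    with assms have "j \<le> K choose 2" by simp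
    from mahonian_pos[OF this] show "1 \<le> card (inv_perms K j)" by (simp add: card_inv_perms)
  qed
  moreover have "sum_list (map (\<lambda>j. card (inv_perms K j)) [0..<Suc d]) =
      (\<Sum>j=0..d. card (inv_perms K j))"
    by (simp only: sum_list_distinct_conv_sum_set distinct_upt set_upt atLeastLessThanSuc_atLeastAtMost)
  ultimately show ?thesis
    by (auto simp: ball_test_def val_layers val_total simp del: upt_Suc)
qed


section \<open>The algorithm\<close>

text \<open>The only access to preferences is through a procedure \<open>D\<close> for their inversion distance; two
  preferences are equal iff their distance is \<open>0\<close>.  A frequency table is a list of the distinct
  preferences of the profile, each with its frequency.\<close>

fun add_vote :: "('a rel \<Rightarrow> 'a rel \<Rightarrow> nat tm) \<Rightarrow> 'a rel \<Rightarrow> ('a rel \<times> nat) list \<Rightarrow>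
    ('a rel \<times> nat) list tm" where
  "add_vote D r [] = do { step; return [(r, 1)] }"
| "add_vote D r ((s, m) # tab) = do {
     step;
     d \<leftarrow> D r s;
     if d = 0 then return ((s, m + 1) # tab)
     else do { tab' \<leftarrow> add_vote D r tab; return ((s, m) # tab') } }"

fun tally :: "('a rel \<Rightarrow> 'a rel \<Rightarrow> nat tm) \<Rightarrow> 'a rel list \<Rightarrow> ('a rel \<times> nat) list \<Rightarrow>
    ('a rel \<times> nat) list tm" where
  "tally D [] tab = do { step; return tab }"
| "tally D (r # \<pi>) tab = do { step; tab' \<leftarrow> add_vote D r tab; tally D \<pi> tab' }"

fun len :: "'b list \<Rightarrow> nat tm" where
  "len [] = do { step; return 0 }"
| "len (x # xs) = do { step; n \<leftarrow> len xs; return (n + 1) }"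

fun factorial :: "nat \<Rightarrow> nat tm" where
  "factorial 0 = do { step; return 1 }"
| "factorial (Suc k) = do { step; f \<leftarrow> factorial k; return (Suc k * f) }"

fun all_freqs_equal :: "('a rel \<times> nat) list \<Rightarrow> bool tm" where
  "all_freqs_equal ((r, m) # (s, m') # tab) = do {
     step;
     if m = m' then all_freqs_equal ((s, m') # tab) else return False }"
| "all_freqs_equal _ = do { step; return True }"

text \<open>Within the check of a candidate, a preference is represented by the pair of its frequency and
  its distance from the candidate, so that each distance is computed only once.\<close>

fun distances :: "('a rel \<Rightarrow> 'a rel \<Rightarrow> nat tm) \<Rightarrow> 'a rel \<Rightarrow> ('a rel \<times> nat) list \<Rightarrow>
    (nat \<times> nat) list tm" where
  "distances D r0 [] = do { step; return [] }"
| "distances D r0 ((r, m) # tab) = do {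
     step;
     d \<leftarrow> D r r0;
     xs \<leftarrow> distances D r0 tab;
     return ((m, d) # xs) }"

fun descents_ok :: "(nat \<times> nat) list \<Rightarrow> bool tm" where
  "descents_ok ((m, d) # (m', d') # xs) = do {
     step;
     if m > m' \<and> d \<ge> d' then return False else descents_ok ((m', d') # xs) }"
| "descents_ok _ = do { step; return True }"

fun final :: "'b list \<Rightarrow> 'b tm" where
  "final [x] = do { step; return x }"
| "final (x # xs) = do { step; final xs }"
| "final [] = do { step; return undefined }"

definition check :: "('a rel \<Rightarrow> 'a rel \<Rightarrow> nat tm) \<Rightarrow> nat \<Rightarrow> ('a rel \<times> nat) list \<Rightarrow> 'a rel \<Rightarrow>
    bool tm" where
  "check D K tab r0 = do {
     step;
     xs \<leftarrow> distances D r0 tab;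
     ys \<leftarrow> msort (\<lambda>(m, d) (m', d'). m > m' \<or> m = m' \<and> d \<le> d') xs;
     ok \<leftarrow> descents_ok ys;
     if \<not> ok then return False
     else do {
       (_, d) \<leftarrow> final ys;
       l \<leftarrow> len ys;
       ball_test K d l } }"

fun search :: "('a rel \<Rightarrow> 'a rel \<Rightarrow> nat tm) \<Rightarrow> nat \<Rightarrow> ('a rel \<times> nat) list \<Rightarrow> nat \<Rightarrow>
    ('a rel \<times> nat) list \<Rightarrow> 'a rel option tm" where
  "search D K tab M [] = do { step; return None }"
| "search D K tab M ((r, m) # cands) = do {
     step;
     if m = M then do {
       ok \<leftarrow> check D K tab r;
       if ok then return (Some r) else search D K tab M cands }
     else return None }"

fun num_alternatives :: "'a set \<Rightarrow> nat tm" where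
  "num_alternatives A = TM (card A) (card A)"  \<comment> \<open>one step for each alternative\<close>

text \<open>The result \<open>None\<close> stands for ``no consensus''.  \<open>frequencies\<close> is the first step of the
  algorithm, which reads the profile; \<open>LC_table\<close> is the rest, which works on the frequency table.\<close>

definition frequencies :: "('a rel \<Rightarrow> 'a rel \<Rightarrow> nat tm) \<Rightarrow> 'a rel list \<Rightarrow>
    ('a rel \<times> nat) list tm" where
  "frequencies D \<pi> = do { step; tally D \<pi> [] }"

definition LC_table :: "('a rel \<Rightarrow> 'a rel \<Rightarrow> nat tm) \<Rightarrow> 'a set \<Rightarrow> ('a rel \<times> nat) list \<Rightarrow>
    'a rel option tm" where
  "LC_table D A tab = do {
     step;
     K \<leftarrow> num_alternatives A;
     l \<leftarrow> len tab;
     eq \<leftarrow> all_freqs_equal tab;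
     f \<leftarrow> factorial K;
     if eq \<and> l = f then return None
     else do {
       sorted \<leftarrow> msort (\<lambda>(r, m) (s, m'). m \<ge> m') tab;
       case sorted of
         [] \<Rightarrow> return None
       | (r, M) # _ \<Rightarrow> search D K sorted M sorted } }"

definition LC :: "('a rel \<Rightarrow> 'a rel \<Rightarrow> nat tm) \<Rightarrow> 'a set \<Rightarrow> 'a rel list \<Rightarrow> 'a rel option tm" where
  "LC D A \<pi> = do { step; tab \<leftarrow> frequencies D \<pi>; LC_table D A tab }"

definition LC_bound :: "nat \<Rightarrow> nat \<Rightarrow> real" where
  "LC_bound K n = (let n' = real (min (fact K) n) in
     n' ^ 2 * (real K * sqrt (ln (real K))) + n' ^ 2 * ln n')"

end

theory Submission
  imports Defs
begin

text \<open>Sort the distinct preferences by frequency and then by distance from the candidate \<open>r0\<close>.  Along this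
  list the distances increase weakly within a group of equal frequency; if they also increase
  strictly at each descent of the frequency, then a more frequent occurring preference is always
  closer to \<open>r0\<close>.  What remains is to separate the occurring preferences from the others: all of them
  lie in the ball around \<open>r0\<close> whose radius is the distance of the last one, so they are strictly closer
  than the others iff they fill the ball, and this can be tested by cardinality.  A ball of radius \<open>d\<close>
  has \<open>\<Sum>j=0..d. card (inv_perms K j)\<close> elements, since listing the preferences turns the distance
  from \<open>r0\<close> into the number of inversions.

  For the running time, \<open>l \<le> n'\<close> candidates are checked on a table of length \<open>l\<close>, each at the cost of
  \<open>l\<close> distances, one merge sort and \<open>K\<close> passes over at most \<open>l\<close> layers.\<close>


section \<open>Orders as lists\<close>

fun rel_of :: "'a list \<Rightarrow> 'a rel" where
  "rel_of [] = {}"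
| "rel_of (x # xs) = {x} \<times> set xs \<union> rel_of xs"

lemma rel_of_subset: "rel_of xs \<subseteq> set xs \<times> set xs"
  by (induction xs) auto

lemma rel_of_in_prefs: "distinct xs \<Longrightarrow> rel_of xs \<in> prefs (set xs)"
proof (induction xs)
  case Nil
  show ?case by (simp add: prefs_def strict_linear_order_on_def trans_def irrefl_def)
next
  case (Cons x xs)
  then have IH: "trans (rel_of xs)" "irrefl (rel_of xs)" "total_on (set xs) (rel_of xs)" and x: "x \<notin> set xs"
    by (auto simp: prefs_def strict_linear_order_on_def)
  have "trans (rel_of (x # xs))"
    using IH(1) x rel_of_subset[of xs] unfolding trans_def by auto
  moreover have "irrefl (rel_of (x # xs))"
    using IH(2) x by (auto simp: irrefl_def)
  moreover have "total_on (set (x # xs)) (rel_of (x # xs))"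
    using IH(3) by (auto simp: total_on_def)
  ultimately show ?case
    using rel_of_subset[of "x # xs"] by (simp add: prefs_def strict_linear_order_on_def)
qed

lemma prefs_asym: "r \<in> prefs A \<Longrightarrow> (a, b) \<in> r \<Longrightarrow> (b, a) \<notin> r"
  unfolding prefs_def strict_linear_order_on_def irrefl_def trans_def by blast

lemma prefs_total: "r \<in> prefs A \<Longrightarrow> a \<in> A \<Longrightarrow> b \<in> A \<Longrightarrow> a \<noteq> b \<Longrightarrow> (a, b) \<in> r \<or> (b, a) \<in> r"
  by (auto simp: prefs_def strict_linear_order_on_def total_on_def)

lemma prefs_subset: "r \<in> prefs A \<Longrightarrow> r \<subseteq> A \<times> A"
  by (simp add: prefs_def)

lemma rel_of_nth:
  "distinct xs \<Longrightarrow> i < length xs \<Longrightarrow> j < length xs \<Longrightarrow> (xs ! i, xs ! j) \<in> rel_of xs \<longleftrightarrow> i < j"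
proof (induction xs arbitrary: i j)
  case (Cons x xs)
  have "(a, b) \<notin> rel_of xs" if "a = x \<or> b = x" for a b
    using that Cons.prems rel_of_subset[of xs] by auto
  with Cons show ?case by (auto simp: nth_Cons split: nat.splits)
qed simp

lemma rel_of_conv_nth:
  "distinct xs \<Longrightarrow> rel_of xs = {(xs ! i, xs ! j) | i j. i < j \<and> j < length xs}"
proof (intro subset_antisym subrelI)
  fix a b assume "distinct xs" and ab: "(a, b) \<in> rel_of xs"
  moreover from ab rel_of_subset[of xs] obtain i j
    where "i < length xs" "j < length xs" "a = xs ! i" "b = xs ! j"
    by (metis in_set_conv_nth mem_Sigma_iff subsetD)
  ultimately show "(a, b) \<in> {(xs ! i, xs ! j) | i j. i < j \<and> j < length xs}"
    using rel_of_nth[of xs i j] by blast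
next
  fix a b assume "distinct xs" "(a, b) \<in> {(xs ! i, xs ! j) | i j. i < j \<and> j < length xs}"
  then show "(a, b) \<in> rel_of xs" by (auto simp: rel_of_nth)
qed

lemma rel_of_inj: "distinct xs \<Longrightarrow> distinct ys \<Longrightarrow> set xs = set ys \<Longrightarrow> rel_of xs = rel_of ys \<Longrightarrow> xs = ys"
proof (induction xs arbitrary: ys)
  case (Cons x xs)
  from Cons.prems(3) obtain y ys' where ys: "ys = y # ys'" by (cases ys) auto
  have "x = y"
  proof (rule ccontr)
    assume "x \<noteq> y"
    with Cons.prems(3) ys have "x \<in> set ys'" "y \<in> set xs" by auto
    then have "(x, y) \<in> rel_of (x # xs)" "(y, x) \<in> rel_of (x # xs)"
      by (simp, simp only: Cons.prems(4) ys) simp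
    then show False using prefs_asym[OF rel_of_in_prefs[OF Cons.prems(1)]] by blast
  qed
  moreover have "rel_of zs = rel_of (x # zs) \<inter> (- {x}) \<times> UNIV" if "x \<notin> set zs" for zs
    using that rel_of_subset[of zs] by auto
  ultimately show ?case
    using Cons ys by (metis distinct.simps(2) insert_ident list.simps(15))
qed simp

lemma prefs_restrict: "r \<in> prefs A \<Longrightarrow> B \<subseteq> A \<Longrightarrow> r \<inter> B \<times> B \<in> prefs B"
  unfolding prefs_def strict_linear_order_on_def irrefl_def total_on_def trans_def by blast

lemma rel_of_surj:
  assumes "finite A" "r \<in> prefs A"
  shows "\<exists>xs. distinct xs \<and> set xs = A \<and> rel_of xs = r"
  using assms
proof (induction "card A" arbitrary: A r)
  case 0
  then show ?case by (intro exI[of _ "[]"]) (auto simp: prefs_def)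
next
  case (Suc n)
  have tr: "trans r" and irr: "irrefl r"
    using Suc.prems by (auto simp: prefs_def strict_linear_order_on_def)
  have "finite r" using Suc.prems prefs_subset finite_subset by blast
  moreover have "acyclic r" using tr irr by (simp add: acyclic_irrefl)
  ultimately have "wf r" by (rule finite_acyclic_wf)
  moreover have "A \<noteq> {}" using Suc.hyps by auto
  ultimately obtain x where x: "x \<in> A" "\<And>y. (y, x) \<in> r \<Longrightarrow> y \<notin> A"
    by (metis wfE_min ex_in_conv)
  let ?B = "A - {x}"
  have "n = card ?B" using Suc.hyps(2) Suc.prems x by simp
  then obtain xs where xs: "distinct xs" "set xs = ?B" "rel_of xs = r \<inter> ?B \<times> ?B"
    using Suc.hyps(1) Suc.prems prefs_restrict[of r A ?B] by blast
  have "(x, b) \<in> r" if "b \<in> ?B" for b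
    using that x prefs_total[OF Suc.prems(2)] by blast
  moreover have "r \<subseteq> A \<times> A" using prefs_subset Suc.prems by blast
  ultimately have "rel_of (x # xs) = r"
    using xs x irr by (auto simp: irrefl_def)
  then show ?case using xs x by (intro exI[of _ "x # xs"]) auto
qed

lemma bij_betw_rel_of:
  assumes "finite A"
  shows "bij_betw rel_of (permutations_of_set A) (prefs A)"
  using rel_of_inj rel_of_surj[OF assms] rel_of_in_prefs
  by (fastforce simp: bij_betw_def inj_on_def permutations_of_set_def)

lemma finite_prefs: "finite A \<Longrightarrow> finite (prefs A)"
  using bij_betw_finite[OF bij_betw_rel_of] by auto

lemma card_prefs: "finite A \<Longrightarrow> card (prefs A) = fact (card A)"
  using bij_betw_same_card[OF bij_betw_rel_of] by fastforce


section \<open>Balls for the inversion distance\<close>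

lemma inv_dist_conv:
  assumes "r \<in> prefs A"
  shows "inv_dist A r s = card (r \<inter> s\<inverse>)"
proof -
  have "{X. \<exists>a\<in>A. \<exists>b\<in>A. a \<noteq> b \<and> X = {a, b} \<and> (a, b) \<in> r \<and> (b, a) \<in> s} =
      (\<lambda>(a, b). {a, b}) ` (r \<inter> s\<inverse>)"
    (is "?L = ?R")
  proof (intro subset_antisym subsetI)
    fix X assume "X \<in> ?R"
    then obtain a b where ab: "X = {a, b}" "(a, b) \<in> r" "(b, a) \<in> s" by auto
    with prefs_subset[OF assms] prefs_asym[OF assms, of a b] have "a \<in> A" "b \<in> A" "a \<noteq> b"
      by blast+
    with ab show "X \<in> ?L" by blast
  qed auto
  moreover have "inj_on (\<lambda>(a, b). {a, b}) (r \<inter> s\<inverse>)"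
  proof (rule inj_onI, clarify)
    fix a b c d assume "(a, b) \<in> r" "(c, d) \<in> r" "{a, b} = {c, d}"
    then show "a = c \<and> b = d" using prefs_asym[OF assms, of a b] by (auto simp: doubleton_eq_iff)
  qed
  ultimately show ?thesis by (simp add: inv_dist_def card_image)
qed

lemma inv_dist_eq_0_iff:
  assumes "finite A" "r \<in> prefs A" "s \<in> prefs A"
  shows "inv_dist A r s = 0 \<longleftrightarrow> r = s"
proof -
  have "finite (r \<inter> s\<inverse>)"
    using assms prefs_subset by (metis finite_Int finite_SigmaI finite_subset)
  then have "inv_dist A r s = 0 \<longleftrightarrow> r \<inter> s\<inverse> = {}"
    using assms by (simp add: inv_dist_conv)
  also have "\<dots> \<longleftrightarrow> r = s"
  proof
    assume disj: "r \<inter> s\<inverse> = {}"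
    have sub: "r' \<subseteq> s'" if "r' \<inter> s'\<inverse> = {}" "r' \<in> prefs A" "s' \<in> prefs A" for r' s'
    proof (rule subrelI)
      fix a b assume ab: "(a, b) \<in> r'"
      then have "a \<in> A" "b \<in> A" "a \<noteq> b"
        using prefs_subset[OF that(2)] prefs_asym[OF that(2), of a b] by blast+
      then show "(a, b) \<in> s'"
        using prefs_total[OF that(3), of a b] ab that(1) by blast
    qed
    from disj have "s \<inter> r\<inverse> = {}" by blast
    with disj show "r = s" using sub assms by blast
  next
    assume "r = s"
    then show "r \<inter> s\<inverse> = {}" using prefs_asym[OF assms(2)] by blast
  qed
  finally show ?thesis .
qed

lemma inv_dist_le:
  assumes "finite A"
  shows "inv_dist A r s \<le> card A choose 2"
proof -
  have "inv_dist A r s \<le> card {X. X \<subseteq> A \<and> card X = 2}"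
    unfolding inv_dist_def using assms by (intro card_mono) auto
  then show ?thesis using assms by (simp add: n_subsets)
qed

lemma nth_image_lessThan: "(!) xs ` {..<length xs} = set xs"
  using nth_image[of "length xs" xs] by (simp add: lessThan_atLeast0)

lemma inv_dist_rel_of:
  assumes zs: "distinct zs" and ys: "ys \<in> permutations_of_set {..<length zs}"
  shows "inv_dist (set zs) (rel_of (map ((!) zs) ys)) (rel_of zs) = inversions ys"
proof -
  have ys': "distinct ys" "set ys = {..<length zs}"
    using ys by (auto simp: permutations_of_set_def)
  have len: "length ys = length zs" using ys' distinct_card[of ys] by simp
  have lt: "ys ! i < length zs" if "i < length ys" for i
    using that ys' nth_mem by blast
  have inj: "inj_on ((!) zs) {..<length zs}"
    using zs by (intro inj_on_nth) auto
  let ?xs = "map ((!) zs) ys"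
  have dist: "distinct ?xs" using ys' inj by (simp add: distinct_map)
  have set: "set ?xs = set zs" using ys' by (simp add: nth_image_lessThan)
  have r: "rel_of ?xs \<in> prefs (set zs)" using rel_of_in_prefs[OF dist] set by simp
  let ?I = "{(i, k). i < k \<and> k < length ys \<and> ys ! k < ys ! i}"
  have "rel_of ?xs \<inter> (rel_of zs)\<inverse> = (\<lambda>(i, k). (?xs ! i, ?xs ! k)) ` ?I"
  proof (intro subset_antisym subsetI)
    fix q assume "q \<in> rel_of ?xs \<inter> (rel_of zs)\<inverse>"
    then obtain i k where q: "q = (?xs ! i, ?xs ! k)" "i < k" "k < length ys" "(?xs ! k, ?xs ! i) \<in> rel_of zs"
      unfolding rel_of_conv_nth[OF dist] by auto
    then have "ys ! k < ys ! i"
      using rel_of_nth[OF zs, of "ys ! k" "ys ! i"] lt by simp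
    with q show "q \<in> (\<lambda>(i, k). (?xs ! i, ?xs ! k)) ` ?I" by force
  next
    fix q assume "q \<in> (\<lambda>(i, k). (?xs ! i, ?xs ! k)) ` ?I"
    then obtain i k where q: "q = (?xs ! i, ?xs ! k)" "i < k" "k < length ys" "ys ! k < ys ! i"
      by auto
    then show "q \<in> rel_of ?xs \<inter> (rel_of zs)\<inverse>"
      using rel_of_nth[OF zs, of "ys ! k" "ys ! i"] rel_of_nth[OF dist, of i k] lt by simp
  qed
  moreover have "inj_on (\<lambda>(i, k). (?xs ! i, ?xs ! k)) ?I"
    using dist by (auto simp: inj_on_def nth_eq_iff_index_eq simp del: nth_map)
  ultimately show ?thesis
    by (simp only: inv_dist_conv[OF r] card_image inversions_def)
qed

lemma card_sphere:
  assumes "finite A" "r0 \<in> prefs A"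
  shows "card {r \<in> prefs A. inv_dist A r r0 = j} = card (inv_perms (card A) j)"
proof -
  obtain zs where zs: "distinct zs" "set zs = A" "rel_of zs = r0"
    using rel_of_surj[OF assms] by blast
  then have K: "card A = length zs" using distinct_card by blast
  let ?P = "permutations_of_set {..<length zs}"
  have inj: "inj_on ((!) zs) {..<length zs}"
    using zs by (intro inj_on_nth) auto
  have img: "(!) zs ` {..<length zs} = A" using zs by (simp add: nth_image_lessThan)
  have "bij_betw (map ((!) zs)) ?P (permutations_of_set A)"
    unfolding bij_betw_def
  proof
    show "inj_on (map ((!) zs)) ?P"
      by (rule inj_on_mapI, rule inj_on_subset[OF inj]) (auto simp: permutations_of_set_def)
  qed (use permutations_of_set_image_inj[OF inj] img in simp)
  from bij_betw_trans[OF this bij_betw_rel_of[OF assms(1)]]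
  have bij: "bij_betw (\<lambda>ys. rel_of (map ((!) zs) ys)) ?P (prefs A)" by (simp add: o_def)
  have eq: "inv_dist A (rel_of (map ((!) zs) ys)) r0 = inversions ys" if "ys \<in> ?P" for ys
    using inv_dist_rel_of[OF zs(1) that] zs by simp
  have "{r \<in> prefs A. inv_dist A r r0 = j} = (\<lambda>ys. rel_of (map ((!) zs) ys)) ` inv_perms (card A) j"
    unfolding inv_perms_def K bij_betw_imp_surj_on[OF bij, symmetric]
    using eq by (auto simp del: permutations_of_setD)
  moreover have "inj_on (\<lambda>ys. rel_of (map ((!) zs) ys)) (inv_perms (card A) j)"
    using bij_betw_imp_inj_on[OF bij] by (rule inj_on_subset) (auto simp: inv_perms_def K)
  ultimately show ?thesis by (simp add: card_image)
qed

lemma card_ball: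
  assumes "finite A" "r0 \<in> prefs A"
  shows "card {r \<in> prefs A. inv_dist A r r0 \<le> d} = (\<Sum>j=0..d. card (inv_perms (card A) j))"
proof -
  have "{r \<in> prefs A. inv_dist A r r0 \<le> d} = (\<Union>j\<in>{0..d}. {r \<in> prefs A. inv_dist A r r0 = j})"
    by auto
  also have "card \<dots> = (\<Sum>j=0..d. card {r \<in> prefs A. inv_dist A r r0 = j})"
    by (rule card_UN_disjoint) (use finite_prefs[OF assms(1)] in auto)
  finally show ?thesis using card_sphere[OF assms] by simp
qed


section \<open>Merge sort\<close>

lemma mset_halve: "mset (fst (val (halve xs))) + mset (snd (val (halve xs))) = mset xs"
  by (induction xs rule: halve.induct) (auto split: prod.splits)

lemma time_halve: "time (halve xs) = length xs div 2 + 1"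
  by (induction xs rule: halve.induct) (auto split: prod.splits)

lemma mset_merge: "mset (val (merge le xs ys)) = mset xs + mset ys"
  by (induction le xs ys rule: merge.induct) auto

lemma time_merge: "time (merge le xs ys) \<le> length xs + length ys + 1"
  by (induction le xs ys rule: merge.induct) auto

lemma sorted_merge:
  assumes "transp le" "totalp le" "reflp le"
  shows "sorted_wrt le xs \<Longrightarrow> sorted_wrt le ys \<Longrightarrow> sorted_wrt le (val (merge le xs ys))"
  using assms
proof (induction le xs ys rule: merge.induct)
  case (3 le x xs y ys)
  have set: "set (val (merge le us vs)) = set us \<union> set vs" for us vs
    using mset_merge[of le us vs] by (metis set_mset_mset set_mset_union)
  have le: "le y x" if "\<not> le x y"
    using that 3(6,7) by (metis totalpD reflpD)
  show ?case
    using 3 set le by (auto dest: transpD)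
qed auto

lemma mset_msort: "mset (val (msort le xs)) = mset xs"
proof (induction le xs rule: msort.induct)
  case (3 le x y zs)
  obtain us vs where uv: "val (halve (x # y # zs)) = (us, vs)" by fastforce
  then show ?case
    using 3 mset_halve[of "x # y # zs"]
    by (simp add: mset_merge del: halve.simps)
qed auto

lemma sorted_msort:
  assumes "transp le" "totalp le" "reflp le"
  shows "sorted_wrt le (val (msort le xs))"
  using assms
proof (induction le xs rule: msort.induct)
  case (3 le x y zs)
  obtain us vs where uv: "val (halve (x # y # zs)) = (us, vs)" by fastforce
  then show ?case
    using 3 by (simp add: sorted_merge del: halve.simps)
qed auto

lemma length_msort: "length (val (msort le xs)) = length xs"
  by (metis mset_msort size_mset)

lemma set_msort: "set (val (msort le xs)) = set xs"
  by (metis mset_msort set_mset_mset)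

text \<open>Both halves have length at most \<open>2/3\<close> of the whole, so each level of the recursion
  decreases \<open>9 n ln n\<close> by at least \<open>9 n ln (3/2) \<ge> 3 n\<close>, which pays for splitting and merging.\<close>

lemma time_msort:
  "xs \<noteq> [] \<Longrightarrow> real (time (msort le xs)) \<le> 9 * real (length xs) * ln (real (length xs)) + real (length xs)"
proof (induction le xs rule: msort.induct)
  case (3 le x y zs)
  define n where "n = length (x # y # zs)"
  obtain us vs where uv: "val (halve (x # y # zs)) = (us, vs)" by fastforce
  have len: "length us = (n + 1) div 2" "length vs = n div 2"
    using length_halve[OF uv] by (simp_all add: n_def)
  have n: "n \<ge> 2" by (simp add: n_def)
  have ne: "us \<noteq> []" "vs \<noteq> []" using len n by auto
  have sum: "real (length us) + real (length vs) = real n"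
  proof -
    have "length us + length vs = n" unfolding len by presburger
    then show ?thesis by (metis of_nat_add)
  qed
  have ln32: "ln (3/2::real) \<ge> 1/3"
    using ln_le_minus_one[of "2/3"] ln_inverse[of "2/3::real"] by simp
  have part: "9 * real m * ln (real m) \<le> 9 * real m * ln (real n) - 3 * real m"
    if "m > 0" "3 * m \<le> 2 * n" for m
  proof -
    have "ln (real m) \<le> ln (real n / (3/2))"
      using that n by (subst ln_le_cancel_iff) auto
    also have "\<dots> \<le> ln (real n) - 1/3"
      using n ln32 by (subst ln_div) auto
    finally have "9 * real m * ln (real m) \<le> 9 * real m * (ln (real n) - 1/3)"
      by (intro mult_left_mono) auto
    then show ?thesis by (simp add: algebra_simps)
  qed
  have m: "3 * length us \<le> 2 * n" "3 * length vs \<le> 2 * n"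
    using len n by presburger+
  have IH: "real (time (msort le us)) \<le> 9 * real (length us) * ln (real (length us)) + real (length us)"
    "real (time (msort le vs)) \<le> 9 * real (length vs) * ln (real (length vs)) + real (length vs)"
    using 3 uv ne by (simp_all del: halve.simps)
  have "time (msort le (x # y # zs)) = 1 + time (halve (x # y # zs)) + time (msort le us)
      + time (msort le vs) + time (merge le (val (msort le us)) (val (msort le vs)))"
    using uv by (simp del: halve.simps)
  also have "\<dots> \<le> 1 + (n div 2 + 1) + time (msort le us) + time (msort le vs) + (length us + length vs + 1)"
    using time_merge[of le "val (msort le us)" "val (msort le vs)"]
    by (simp add: time_halve n_def length_msort del: halve.simps)
  finally have "real (time (msort le (x # y # zs))) \<le> real (1 + (n div 2 + 1) + time (msort le us)
      + time (msort le vs) + (length us + length vs + 1))"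
    by (rule of_nat_mono)
  also have "\<dots> \<le> 3 + real n / 2 + (real (time (msort le us)) + real (time (msort le vs))) + real n"
  proof -
    have "real (n div 2) \<le> real n / 2" by linarith
    with sum show ?thesis by simp
  qed
  also have "\<dots> \<le> 3 + real n / 2 + (9 * real (length us) * ln (real n) - 3 * real (length us) + real (length us)
      + (9 * real (length vs) * ln (real n) - 3 * real (length vs) + real (length vs))) + real n"
    using IH part[of "length us"] part[of "length vs"] ne m by simp
  also have "\<dots> = 3 + real n / 2 + 9 * (real (length us) + real (length vs)) * ln (real n)
      - 2 * (real (length us) + real (length vs)) + real n"
    by (simp add: algebra_simps)
  also have "\<dots> \<le> 9 * real n * ln (real n) + real n"
    unfolding sum using n by simp
  finally show ?case unfolding n_def .
qed auto


section \<open>The counting test\<close>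

lemma time_zeros: "time (zeros m) = m + 1"
  by (induction m) auto

lemma time_psums: "time (psums a xs) = length xs + 1"
  by (induction xs arbitrary: a) auto

lemma time_lagdiff: "time (lagdiff k ps qs) \<le> length ps + 1"
  by (induction k ps qs rule: lagdiff.induct) auto

lemma time_total: "time (total xs) = length xs + 1"
  by (induction xs) auto

lemma time_layers: "time (layers K m) \<le> (K + 1) * (2 * m + 5)"
proof (induction K)
  case (Suc K)
  have "time (layers (Suc K) m) \<le> 1 + time (layers K m) + (m + 2) + (m + 2)"
    using time_lagdiff[of "Suc K" "val (psums 0 (val (layers K m)))"]
    by (simp add: time_psums val_psums val_layers del: lagdiff.simps)
  with Suc show ?case by simp
qed (simp add: time_zeros)

lemma time_ball_test: "time (ball_test K d l) \<le> (K + 2) * (2 * l + 3) + 2"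
proof (cases "d < l")
  case True
  then have "time (ball_test K d l) \<le> 1 + (K + 1) * (2 * d + 5) + (d + 2)"
    using time_layers[of K d] by (simp add: ball_test_def time_total val_layers)
  also have "\<dots> \<le> 1 + (K + 1) * (2 * l + 3) + (l + 1)"
  proof -
    have "(K + 1) * (2 * d + 5) \<le> (K + 1) * (2 * l + 3)"
      using True by (intro mult_le_mono2) simp
    with True show ?thesis by linarith
  qed
  finally show ?thesis by simp
qed (simp add: ball_test_def)


section \<open>Descents\<close>

lemma time_len: "time (len xs) = length xs + 1"
  by (induction xs) auto

lemma val_len: "val (len xs) = length xs"
  by (induction xs) auto

lemma time_factorial: "time (factorial k) = k + 1"
  by (induction k) auto

lemma val_factorial: "val (factorial k) = fact k"
  by (induction k) auto

lemma time_all_freqs_equal: "time (all_freqs_equal tab) \<le> length tab + 1"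
  by (induction tab rule: all_freqs_equal.induct) auto

lemma val_all_freqs_equal:
  "val (all_freqs_equal tab) \<longleftrightarrow> (\<forall>p\<in>set tab. \<forall>q\<in>set tab. snd p = snd q)"
  by (induction tab rule: all_freqs_equal.induct) auto

lemma time_final: "time (final xs) \<le> length xs + 1"
  by (induction xs rule: final.induct) auto

lemma val_final: "xs \<noteq> [] \<Longrightarrow> val (final xs) = last xs"
  by (induction xs rule: final.induct) auto

lemma time_descents_ok: "time (descents_ok xs) \<le> length xs + 1"
  by (induction xs rule: descents_ok.induct) auto

definition key_le :: "nat \<times> nat \<Rightarrow> nat \<times> nat \<Rightarrow> bool" where
  "key_le = (\<lambda>(m, d) (m', d'). m > m' \<or> m = m' \<and> d \<le> d')"

definition key_prec :: "nat \<times> nat \<Rightarrow> nat \<times> nat \<Rightarrow> bool" where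
  "key_prec = (\<lambda>(m, d) (m', d'). m > m' \<and> d < d' \<or> m = m' \<and> d \<le> d')"

lemma key_le_simp: "key_le (m, d) (m', d') \<longleftrightarrow> m > m' \<or> m = m' \<and> d \<le> d'"
  by (simp add: key_le_def)

lemma key_prec_simp: "key_prec (m, d) (m', d') \<longleftrightarrow> m > m' \<and> d < d' \<or> m = m' \<and> d \<le> d'"
  by (simp add: key_prec_def)

lemma key_le_order: "transp key_le" "totalp key_le" "reflp key_le"
  by (auto simp: key_le_def transp_def totalp_on_def reflp_def)

lemma transp_key_prec: "transp key_prec"
  by (auto simp: key_prec_def transp_def)

lemma val_descents_ok:
  "sorted_wrt key_le xs \<Longrightarrow> val (descents_ok xs) \<longleftrightarrow> sorted_wrt key_prec xs"
proof (induction xs rule: descents_ok.induct)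
  case (1 m d m' d' xs)
  then show ?case
    by (auto simp: sorted_wrt2[OF transp_key_prec] sorted_wrt2[OF key_le_order(1)]
        key_le_simp key_prec_simp simp del: sorted_wrt.simps(2))
qed auto

lemma sorted_key_prec_iff:
  assumes "sorted_wrt key_le xs"
  shows "sorted_wrt key_prec xs \<longleftrightarrow>
    (\<forall>(m, d)\<in>set xs. \<forall>(m', d')\<in>set xs. m > m' \<longrightarrow> d < d')"
  using assms
proof (induction xs)
  case (Cons x xs)
  then show ?case
    by (cases x) (fastforce simp: key_le_simp key_prec_simp)
qed simp

lemma key_prec_last: "sorted_wrt key_prec xs \<Longrightarrow> x \<in> set xs \<Longrightarrow> snd x \<le> snd (last xs)"
proof (induction xs)
  case (Cons y xs)
  then have "key_prec y (last xs)" if "xs \<noteq> []" using that by simp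
  then have "snd y \<le> snd (last xs)" if "xs \<noteq> []"
    using that by (cases y; cases "last xs") (auto simp: key_prec_simp)
  with Cons show ?case by auto
qed simp


section \<open>The frequency table\<close>

lemma count_list_pos_iff: "0 < count_list xs x \<longleftrightarrow> x \<in> set xs"
  using count_list_0_iff[of xs x] by (simp add: zero_less_iff_neq_zero)

definition is_table :: "'a rel list \<Rightarrow> ('a rel \<times> nat) list \<Rightarrow> bool" where
  "is_table \<pi> tab \<longleftrightarrow> distinct (map fst tab) \<and> set tab = (\<lambda>r. (r, count_list \<pi> r)) ` set \<pi>"

lemma is_table_fst: "is_table \<pi> tab \<Longrightarrow> fst ` set tab = set \<pi>"
  by (auto simp: is_table_def image_image)

lemma is_table_length: "is_table \<pi> tab \<Longrightarrow> length tab = card (set \<pi>)"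
  using is_table_fst[of \<pi> tab] distinct_card[of "map fst tab"] by (simp add: is_table_def)

lemma is_table_iff_map_of:
  "is_table \<pi> tab \<longleftrightarrow> distinct (map fst tab) \<and>
    map_of tab = (\<lambda>r. if r \<in> set \<pi> then Some (count_list \<pi> r) else None)"
proof -
  have "set tab = (\<lambda>r. (r, count_list \<pi> r)) ` set \<pi> \<longleftrightarrow>
      map_of tab = (\<lambda>r. if r \<in> set \<pi> then Some (count_list \<pi> r) else None)"
    if dist: "distinct (map fst tab)"
  proof
    assume *: "set tab = (\<lambda>r. (r, count_list \<pi> r)) ` set \<pi>"
    show "map_of tab = (\<lambda>r. if r \<in> set \<pi> then Some (count_list \<pi> r) else None)"
    proof
      fix r
      show "map_of tab r = (if r \<in> set \<pi> then Some (count_list \<pi> r) else None)"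
        using dist by (cases "r \<in> set \<pi>") (simp_all add: * map_of_eq_None_iff image_image)
    qed
  next
    assume *: "map_of tab = (\<lambda>r. if r \<in> set \<pi> then Some (count_list \<pi> r) else None)"
    have "p \<in> set tab \<longleftrightarrow> p \<in> (\<lambda>r. (r, count_list \<pi> r)) ` set \<pi>" for p
      using map_of_eq_Some_iff[OF dist, of "fst p" "snd p"] by (cases p) (auto simp: * split: if_splits)
    then show "set tab = (\<lambda>r. (r, count_list \<pi> r)) ` set \<pi>" by blast
  qed
  then show ?thesis by (auto simp: is_table_def)
qed

locale distance_procedure =
  fixes A :: "'a set" and D :: "'a rel \<Rightarrow> 'a rel \<Rightarrow> nat tm" and t :: nat
  assumes finite: "finite A"
    and card: "card A \<ge> 3"
    and val_D: "r \<in> prefs A \<Longrightarrow> s \<in> prefs A \<Longrightarrow> val (D r s) = inv_dist A r s"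
    and time_D: "r \<in> prefs A \<Longrightarrow> s \<in> prefs A \<Longrightarrow> time (D r s) \<le> t"
begin

lemma val_D_eq_0: "r \<in> prefs A \<Longrightarrow> s \<in> prefs A \<Longrightarrow> val (D r s) = 0 \<longleftrightarrow> r = s"
  by (simp add: val_D inv_dist_eq_0_iff[OF finite])

lemma val_add_vote:
  assumes "r \<in> prefs A" "fst ` set tab \<subseteq> prefs A" "distinct (map fst tab)"
  shows "fst ` set (val (add_vote D r tab)) = insert r (fst ` set tab) \<and>
    distinct (map fst (val (add_vote D r tab))) \<and>
    map_of (val (add_vote D r tab)) =
      (map_of tab)(r \<mapsto> (case map_of tab r of None \<Rightarrow> 1 | Some m \<Rightarrow> m + 1))"
  using assms
proof (induction tab)
  case (Cons p tab)
  obtain s m where p: "p = (s, m)" by fastforce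
  with Cons.prems have s: "s \<in> prefs A" "s \<notin> fst ` set tab" by auto
  show ?case
  proof (cases "r = s")
    case True
    then show ?thesis using Cons.prems s p val_D_eq_0[of r s] by auto
  next
    case False
    then have "val (D r s) \<noteq> 0" using Cons.prems s val_D_eq_0 by blast
    then show ?thesis using Cons False s p by (auto simp: fun_upd_twist)
  qed
qed auto

lemma time_add_vote:
  assumes "r \<in> prefs A" "fst ` set tab \<subseteq> prefs A"
  shows "time (add_vote D r tab) \<le> length tab * (t + 1) + 1"
  using assms
proof (induction tab)
  case (Cons p tab)
  obtain s m where p: "p = (s, m)" by fastforce
  with Cons.prems have "time (D r s) \<le> t" by (simp add: time_D)
  then show ?case using Cons p by simp
qed auto

lemma is_table_add_vote:
  assumes "is_table \<rho> tab" "set \<rho> \<subseteq> prefs A" "r \<in> prefs A"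
  shows "is_table (r # \<rho>) (val (add_vote D r tab))"
proof -
  have tab: "distinct (map fst tab)" "fst ` set tab \<subseteq> prefs A"
    "map_of tab = (\<lambda>r. if r \<in> set \<rho> then Some (count_list \<rho> r) else None)"
    using assms is_table_fst is_table_iff_map_of by blast+
  show ?thesis
    unfolding is_table_iff_map_of
    using val_add_vote[OF assms(3) tab(2,1)] by (auto simp: tab(3) fun_eq_iff)
qed

lemma tally:
  assumes "is_table \<rho> tab" "set \<rho> \<subseteq> prefs A" "set \<pi> \<subseteq> prefs A"
  shows "is_table (rev \<pi> @ \<rho>) (val (tally D \<pi> tab)) \<and>
    time (tally D \<pi> tab) \<le> length \<pi> * (2 + (length \<pi> + length \<rho>) * (t + 1)) + 1"
  using assms
proof (induction \<pi> arbitrary: \<rho> tab)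
  case (Cons r \<pi>)
  let ?tab = "val (add_vote D r tab)"
  have tab: "is_table (r # \<rho>) ?tab" using Cons.prems by (simp add: is_table_add_vote)
  from Cons.IH[OF this] Cons.prems
  have IH: "is_table (rev \<pi> @ r # \<rho>) (val (tally D \<pi> ?tab))"
    "time (tally D \<pi> ?tab) \<le> length \<pi> * (2 + (length \<pi> + length (r # \<rho>)) * (t + 1)) + 1"
    by auto
  have "length tab \<le> length \<rho>"
    using is_table_length[OF Cons.prems(1)] card_length by simp
  then have "length tab * (t + 1) \<le> (length (r # \<pi>) + length \<rho>) * (t + 1)"
    by (intro mult_right_mono) auto
  moreover have "time (add_vote D r tab) \<le> length tab * (t + 1) + 1"
    using Cons.prems is_table_fst[OF Cons.prems(1)] by (intro time_add_vote) auto
  ultimately have "time (add_vote D r tab) \<le> (length (r # \<pi>) + length \<rho>) * (t + 1) + 1"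
    by linarith
  with IH show ?case by simp
qed simp

lemma is_table_frequencies:
  assumes "set \<pi> \<subseteq> prefs A"
  shows "is_table \<pi> (val (frequencies D \<pi>))"
proof -
  have "is_table (rev \<pi>) (val (frequencies D \<pi>))"
    using tally[of "[]" "[]" \<pi>] assms by (simp add: frequencies_def is_table_def)
  then show ?thesis by (simp add: is_table_def)
qed

lemma time_frequencies:
  assumes "set \<pi> \<subseteq> prefs A"
  shows "time (frequencies D \<pi>) \<le> length \<pi> * (2 + length \<pi> * (t + 1)) + 2"
  using tally[of "[]" "[]" \<pi>] assms by (simp add: frequencies_def is_table_def)


section \<open>The check of a candidate\<close>

lemma val_distances:
  assumes "r0 \<in> prefs A" "fst ` set tab \<subseteq> prefs A"
  shows "val (distances D r0 tab) = map (\<lambda>(r, m). (m, inv_dist A r r0)) tab"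
  using assms(2) by (induction tab) (auto simp: val_D assms(1))

lemma time_distances:
  assumes "r0 \<in> prefs A" "fst ` set tab \<subseteq> prefs A"
  shows "time (distances D r0 tab) \<le> length tab * (t + 1) + 1"
  using assms(2)
proof (induction tab)
  case (Cons p tab)
  obtain s m where p: "p = (s, m)" by fastforce
  with Cons.prems have "time (D s r0) \<le> t" using assms(1) by (simp add: time_D)
  then show ?case using Cons p by simp
qed auto

definition monotone_around :: "'a rel list \<Rightarrow> 'a rel \<Rightarrow> bool" where
  "monotone_around \<pi> r0 \<longleftrightarrow> (\<forall>r\<in>prefs A. \<forall>s\<in>prefs A.
     inv_dist A r r0 \<le> inv_dist A s r0 \<longrightarrow> count_list \<pi> r \<ge> count_list \<pi> s)"

lemma level1_around_iff:
  "level1_around A \<pi> r0 \<longleftrightarrow> r0 \<in> prefs A \<and> monotone_around \<pi> r0 \<and>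
     (\<exists>r\<in>prefs A. \<exists>s\<in>prefs A. count_list \<pi> r > count_list \<pi> s)"
  unfolding level1_around_def monotone_around_def by (meson not_le)

lemma val_check:
  assumes tab: "is_table \<pi> tab" and ne: "\<pi> \<noteq> []" and \<pi>: "set \<pi> \<subseteq> prefs A" and r0: "r0 \<in> prefs A"
  shows "val (check D (card A) tab r0) \<longleftrightarrow> monotone_around \<pi> r0"
proof -
  let ?n = "count_list \<pi>" and ?d = "\<lambda>r. inv_dist A r r0"
  define xs where "xs = val (distances D r0 tab)"
  define ys where "ys = val (msort key_le xs)"
  define e where "e = snd (last ys)"
  let ?ball = "{r \<in> prefs A. ?d r \<le> e}"
  have xs: "xs = map (\<lambda>(r, m). (m, ?d r)) tab"
    unfolding xs_def using r0 \<pi> is_table_fst[OF tab] by (intro val_distances) auto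
  have set_ys: "set ys = (\<lambda>r. (?n r, ?d r)) ` set \<pi>"
    using tab by (simp add: ys_def set_msort xs is_table_def image_image)
  have len_ys: "length ys = card (set \<pi>)"
    using is_table_length[OF tab] by (simp add: ys_def length_msort xs)
  have ys_ne: "ys \<noteq> []" using ne set_ys by auto
  have sorted: "sorted_wrt key_le ys"
    unfolding ys_def by (intro sorted_msort key_le_order)
  have ok: "val (descents_ok ys) \<longleftrightarrow> (\<forall>r\<in>set \<pi>. \<forall>s\<in>set \<pi>. ?n r > ?n s \<longrightarrow> ?d r < ?d s)"
    unfolding val_descents_ok[OF sorted] sorted_key_prec_iff[OF sorted] set_ys by simp
  have "last ys \<in> set ys" using ys_ne by simp
  then obtain r1 where r1: "r1 \<in> set \<pi>" "e = ?d r1"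
    unfolding set_ys e_def by auto
  have ball: "val (ball_test (card A) e (length ys)) \<longleftrightarrow> card ?ball = card (set \<pi>)"
    using r1 inv_dist_le[OF finite] by (subst val_ball_test) (auto simp: card_ball[OF finite r0] len_ys)
  have check: "val (check D (card A) tab r0) \<longleftrightarrow> val (descents_ok ys) \<and> card ?ball = card (set \<pi>)"
  proof -
    obtain m where "last ys = (m, e)" unfolding e_def by (metis prod.collapse)
    then show ?thesis
      by (simp add: check_def key_le_def[symmetric] xs_def[symmetric] ys_def[symmetric]
          val_final[OF ys_ne] val_len ball)
  qed
  have in_ball: "set \<pi> \<subseteq> ?ball" if "val (descents_ok ys)"
  proof
    fix r assume r: "r \<in> set \<pi>"
    then have "(?n r, ?d r) \<in> set ys" by (simp add: set_ys)
    then have "?d r \<le> e"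
      using that key_prec_last[of ys "(?n r, ?d r)"] by (simp add: val_descents_ok[OF sorted] e_def)
    then show "r \<in> ?ball" using r \<pi> by auto
  qed
  have fin: "Finite_Set.finite ?ball" using finite_prefs[OF finite] by simp
  show ?thesis
  proof
    assume *: "val (check D (card A) tab r0)"
    then have desc: "val (descents_ok ys)" and "card ?ball = card (set \<pi>)"
      using check by simp_all
    then have full: "set \<pi> = ?ball"
      using card_subset_eq[OF fin in_ball[OF desc]] by simp
    show "monotone_around \<pi> r0"
      unfolding monotone_around_def
    proof (intro ballI impI, rule ccontr)
      fix r s assume rs: "r \<in> prefs A" "s \<in> prefs A" "?d r \<le> ?d s" "\<not> ?n s \<le> ?n r"
      then have "0 < ?n s" by linarith
      then have s: "s \<in> set \<pi>" by (simp only: count_list_pos_iff)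
      then have "?d s \<le> e" using full by blast
      with rs have "r \<in> set \<pi>" unfolding full by simp
      with s desc ok rs(4) have "?d r > ?d s" by (simp add: not_le)
      with rs(3) show False by simp
    qed
  next
    assume *: "monotone_around \<pi> r0"
    have desc: "val (descents_ok ys)"
      unfolding ok
    proof (intro ballI impI, rule ccontr)
      fix r s assume "r \<in> set \<pi>" "s \<in> set \<pi>" "?n s < ?n r" "\<not> ?d r < ?d s"
      moreover from this \<pi> have "r \<in> prefs A" "s \<in> prefs A" by blast+
      ultimately show False
        using *[unfolded monotone_around_def, rule_format, of s r] by simp
    qed
    have "?ball \<subseteq> set \<pi>"
    proof
      fix r assume "r \<in> ?ball"
      moreover have "r1 \<in> prefs A" using r1 \<pi> by blast
      ultimately have "?n r1 \<le> ?n r"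
        using *[unfolded monotone_around_def, rule_format, of r r1] r1 by simp
      moreover have "0 < ?n r1" using r1 by (simp only: count_list_pos_iff)
      ultimately have "0 < ?n r" by linarith
      then show "r \<in> set \<pi>" by (simp only: count_list_pos_iff)
    qed
    with in_ball[OF desc] have "?ball = set \<pi>" by blast
    with desc check show "val (check D (card A) tab r0)" by simp
  qed
qed

lemma time_check:
  assumes tab: "tab \<noteq> []" "fst ` set tab \<subseteq> prefs A" and r0: "r0 \<in> prefs A"
  defines "l \<equiv> real (length tab)"
  shows "real (time (check D (card A) tab r0)) \<le> l * (real t + 13 * real (card A) + 9 * ln l)"
proof -
  define K where "K = card A"
  define xs where "xs = val (distances D r0 tab)"
  define ys where "ys = val (msort key_le xs)"
  have len: "length xs = length tab" "length ys = length tab"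
    using val_distances[OF r0 tab(2)] by (simp_all add: xs_def ys_def length_msort)
  have l: "l \<ge> 1" using tab by (cases tab) (simp_all add: l_def)
  have K: "real K \<ge> 3" using card by (simp add: K_def)
  have "time (check D K tab r0) \<le> 1 + time (distances D r0 tab) + time (msort key_le xs) +
      time (descents_ok ys) + time (final ys) + time (len ys) +
      time (ball_test K (snd (val (final ys))) (length ys))"
    by (simp add: check_def key_le_def[symmetric] xs_def[symmetric] ys_def[symmetric] val_len
        split: prod.splits)
  also have "\<dots> \<le> 1 + (length tab * (t + 1) + 1) + time (msort key_le xs) + (length tab + 1)
      + (length tab + 1) + (length tab + 1) + ((K + 2) * (2 * length tab + 3) + 2)"
    using time_distances[OF r0 tab(2)] time_descents_ok[of ys] time_final[of ys] len
      time_ball_test[of K "snd (val (final ys))" "length ys"]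
    by (intro add_mono) (simp_all add: time_len)
  finally have "real (time (check D K tab r0)) \<le> real \<dots>" by (rule of_nat_mono)
  also have "\<dots> \<le> (l * (real t + 1) + 7) + (9 * l * ln l + l) + 3 * l + (real K + 2) * (2 * l + 3)"
  proof -
    have "xs \<noteq> []" using tab len by auto
    from time_msort[OF this, of key_le] len
    have "real (time (msort key_le xs)) \<le> 9 * l * ln l + l" by (simp add: l_def)
    then show ?thesis by (simp add: l_def algebra_simps)
  qed
  also have "\<dots> \<le> l * (real t + 1) + 7 * l + 9 * l * ln l + 4 * l + (real K + 2) * (5 * l)"
  proof -
    have "(real K + 2) * (2 * l + 3) \<le> (real K + 2) * (5 * l)"
      using l by (intro mult_left_mono) auto
    with l show ?thesis by linarith
  qed
  also have "\<dots> = l * (real t + 9 * ln l + 5 * real K + 22)"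
    by (simp add: algebra_simps)
  also have "\<dots> \<le> l * (real t + 13 * real K + 9 * ln l)"
    using l K by (intro mult_left_mono) auto
  finally show ?thesis by (simp add: K_def)
qed


section \<open>The algorithm\<close>

lemma search_Some:
  "val (search D K tab M cands) = Some r \<Longrightarrow> r \<in> fst ` set cands \<and> val (check D K tab r)"
  by (induction cands) (auto split: if_splits)

lemma search_None:
  assumes "val (search D K tab M cands) = None" "sorted_wrt (\<lambda>p q. snd p \<ge> snd q) cands"
    and "\<forall>p\<in>set cands. snd p \<le> M" "(r, M) \<in> set cands"
  shows "\<not> val (check D K tab r)"
  using assms by (induction cands) (fastforce split: if_splits)+

lemma time_search:
  assumes "\<And>p. p \<in> set cands \<Longrightarrow> real (time (check D K tab (fst p))) \<le> b"
  shows "real (time (search D K tab M cands)) \<le> real (length cands) * (b + 1) + 1"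
  using assms
proof (induction cands)
  case (Cons p cands)
  obtain s m where p: "p = (s, m)" by fastforce
  have "real (time (check D K tab s)) \<le> b" using Cons.prems[of p] p by simp
  moreover from this have "0 \<le> b" by linarith
  ultimately show ?case using Cons p by (auto simp: algebra_simps intro: add_nonneg_nonneg)
qed auto

lemma is_table_msort: "is_table \<pi> (val (msort le tab)) \<longleftrightarrow> is_table \<pi> tab"
proof -
  have "distinct (map fst (val (msort le tab))) \<longleftrightarrow> distinct (map fst tab)"
    by (rule mset_eq_imp_distinct_iff) (simp add: mset_msort)
  then show ?thesis by (simp add: is_table_def set_msort)
qed

lemma sorted_table:
  fixes tab :: "('a rel \<times> nat) list"
  shows "sorted_wrt (\<lambda>p q. snd p \<ge> snd q) (val (msort (\<lambda>(r, m) (s, m'). m \<ge> m') tab))"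
proof -
  have eq: "(\<lambda>(r :: 'a rel, m :: nat) (s :: 'a rel, m'). m \<ge> m') = (\<lambda>p q. snd p \<ge> snd q)"
    by (auto simp: fun_eq_iff)
  show ?thesis
    unfolding eq by (rule sorted_msort) (auto simp: transp_def totalp_on_def reflp_def)
qed

lemma constant_frequencies_iff:
  assumes tab: "is_table \<pi> tab" and ne: "\<pi> \<noteq> []" and \<pi>: "set \<pi> \<subseteq> prefs A"
  shows "val (all_freqs_equal tab) \<and> length tab = fact (card A) \<longleftrightarrow>
    \<not> (\<exists>r\<in>prefs A. \<exists>s\<in>prefs A. count_list \<pi> r > count_list \<pi> s)"
proof -
  have eq: "val (all_freqs_equal tab) \<longleftrightarrow> (\<forall>r\<in>set \<pi>. \<forall>s\<in>set \<pi>. count_list \<pi> r = count_list \<pi> s)"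
    using tab by (simp add: val_all_freqs_equal is_table_def)
  have full: "length tab = fact (card A) \<longleftrightarrow> set \<pi> = prefs A"
    unfolding is_table_length[OF tab] card_prefs[OF finite, symmetric]
    using card_subset_eq[OF finite_prefs[OF finite] \<pi>] by metis
  show ?thesis
  proof
    assume "\<not> (\<exists>r\<in>prefs A. \<exists>s\<in>prefs A. count_list \<pi> r > count_list \<pi> s)"
    then have *: "count_list \<pi> r = count_list \<pi> s" if "r \<in> prefs A" "s \<in> prefs A" for r s
      using that by (cases "count_list \<pi> r" "count_list \<pi> s" rule: linorder_cases) blast+
    have hd: "hd \<pi> \<in> set \<pi>" using ne by simp
    have "s \<in> set \<pi>" if "s \<in> prefs A" for s
    proof -
      have "count_list \<pi> s = count_list \<pi> (hd \<pi>)"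
        using that hd \<pi> by (intro *) blast+
      with hd show ?thesis by (simp only: count_list_pos_iff[symmetric])
    qed
    then have "set \<pi> = prefs A" using \<pi> by blast
    with * show "val (all_freqs_equal tab) \<and> length tab = fact (card A)"
      unfolding eq full by blast
  next
    assume "val (all_freqs_equal tab) \<and> length tab = fact (card A)"
    then show "\<not> (\<exists>r\<in>prefs A. \<exists>s\<in>prefs A. count_list \<pi> r > count_list \<pi> s)"
      unfolding eq full by (metis less_irrefl)
  qed
qed

lemma LC_table_correct:
  assumes tab: "is_table \<pi> tab" and \<pi>: "set \<pi> \<subseteq> prefs A"
  shows "case val (LC_table D A tab) of None \<Rightarrow> \<not> level1 A \<pi> | Some r0 \<Rightarrow> level1_around A \<pi> r0"
proof (cases "\<pi> = []")
  case True
  with tab have "tab = []" by (simp add: is_table_def)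
  then have "val (LC_table D A tab) = None"
    by (simp add: LC_table_def)
  with True show ?thesis by (simp add: level1_def level1_around_def)
next
  case ne: False
  define ys where "ys = val (msort (\<lambda>(r, m) (s, m'). m \<ge> m') tab)"
  have ys: "is_table \<pi> ys" using tab by (simp add: ys_def is_table_msort)
  have "ys \<noteq> []" using ys ne by (auto simp: is_table_def)
  then obtain r1 M cands where ys_Cons: "ys = (r1, M) # cands"
    by (metis neq_Nil_conv surj_pair)
  have sorted: "sorted_wrt (\<lambda>p q. snd p \<ge> snd q) ys"
    unfolding ys_def by (rule sorted_table)
  then have M: "\<forall>p\<in>set ys. snd p \<le> M" using ys_Cons by auto
  let ?differ = "\<exists>r\<in>prefs A. \<exists>s\<in>prefs A. count_list \<pi> r > count_list \<pi> s"
  have val: "val (LC_table D A tab) =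
      (if ?differ then val (search D (card A) ys M ys) else None)"
    using constant_frequencies_iff[OF tab ne \<pi>] ys_Cons
    by (auto simp: LC_table_def val_len val_factorial ys_def[symmetric]
        simp del: search.simps)
  show ?thesis
  proof (cases "val (LC_table D A tab)")
    case None
    have "\<not> level1_around A \<pi> r0" for r0
    proof
      assume r0: "level1_around A \<pi> r0"
      then have mono: "r0 \<in> prefs A" "monotone_around \<pi> r0" and ?differ
        by (simp_all add: level1_around_iff)
      then have search: "val (search D (card A) ys M ys) = None" using None val by simp
      have "inv_dist A r0 r0 = 0" using inv_dist_eq_0_iff[OF finite] mono by simp
      then have max: "count_list \<pi> r \<le> count_list \<pi> r0" if "r \<in> prefs A" for r
        using that mono by (simp add: monotone_around_def)
      have "(r1, M) \<in> set ys" by (simp add: ys_Cons)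
      then have r1: "r1 \<in> set \<pi>" "M = count_list \<pi> r1" using ys by (auto simp: is_table_def)
      then have le: "M \<le> count_list \<pi> r0" using max[of r1] \<pi> by auto
      moreover have "0 < M" unfolding r1(2) count_list_pos_iff by (rule r1(1))
      ultimately have "0 < count_list \<pi> r0" by linarith
      then have "r0 \<in> set \<pi>" by (simp only: count_list_pos_iff)
      then have *: "(r0, count_list \<pi> r0) \<in> set ys" using ys by (simp add: is_table_def)
      with M have "count_list \<pi> r0 \<le> M" by fastforce
      with le * have "(r0, M) \<in> set ys" by simp
      from search_None[OF search sorted M this] val_check[OF ys ne \<pi> mono(1)] mono(2)
      show False by simp
    qed
    with None show ?thesis by (simp add: level1_def)
  next
    case (Some r0)
    then have differ: ?differ and "val (search D (card A) ys M ys) = Some r0"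
      using val by (simp_all split: if_splits)
    from search_Some[OF this(2)] have r0: "r0 \<in> prefs A" "val (check D (card A) ys r0)"
      using is_table_fst[OF ys] \<pi> by auto
    with val_check[OF ys ne \<pi> r0(1)] differ have "level1_around A \<pi> r0"
      by (simp add: level1_around_iff)
    with Some show ?thesis by simp
  qed
qed

lemma LC_correct:
  assumes "set \<pi> \<subseteq> prefs A"
  shows "case val (LC D A \<pi>) of None \<Rightarrow> \<not> level1 A \<pi> | Some r0 \<Rightarrow> level1_around A \<pi> r0"
  using LC_table_correct[OF is_table_frequencies[OF assms] assms] by (simp add: LC_def)

lemma time_LC_table:
  assumes tab: "is_table \<pi> tab" and \<pi>: "set \<pi> \<subseteq> prefs A" and ne: "\<pi> \<noteq> []"
  defines "l \<equiv> real (card (set \<pi>))"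
  shows "real (time (LC_table D A tab)) \<le> l\<^sup>2 * (real t + 18 * real (card A) + 18 * ln l)"
proof -
  define K where "K = card A"
  define le :: "'a rel \<times> nat \<Rightarrow> 'a rel \<times> nat \<Rightarrow> bool" where "le = (\<lambda>(r, m) (s, m'). m \<ge> m')"
  define ys where "ys = val (msort le tab)"
  define b where "b = l * (real t + 13 * real K + 9 * ln l)"
  have len: "length tab = card (set \<pi>)" by (rule is_table_length[OF tab])
  have len_ys: "length ys = card (set \<pi>)" by (simp add: ys_def length_msort len)
  have fst_ys: "fst ` set ys \<subseteq> prefs A" using \<pi> is_table_fst[OF tab] by (simp add: ys_def set_msort)
  have pos: "card (set \<pi>) > 0" using ne by (simp add: card_gt_0_iff)
  then have ne': "tab \<noteq> []" "ys \<noteq> []" using len len_ys by auto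
  have l: "l \<ge> 1" using pos by (simp add: l_def)
  have K: "real K \<ge> 3" using card by (simp add: K_def)
  obtain r1 M cands where ys_Cons: "ys = (r1, M) # cands"
    using ne' by (metis neq_Nil_conv surj_pair)
  have "real (time (search D K ys M ys)) \<le> real (length ys) * (b + 1) + 1"
  proof (rule time_search)
    fix p assume "p \<in> set ys"
    then have "fst p \<in> prefs A" using fst_ys by auto
    from time_check[OF ne'(2) fst_ys this]
    show "real (time (check D K ys (fst p))) \<le> b" by (simp add: b_def K_def len_ys l_def)
  qed
  then have search: "real (time (search D K ys M ys)) \<le> l * (b + 1) + 1"
    by (simp add: len_ys l_def)
  have sort: "real (time (msort le tab)) \<le> 9 * l * ln l + l"
    using time_msort[OF ne'(1), of le] by (simp add: len l_def)
  have "time (LC_table D A tab) \<le> 1 + K + time (len tab) + time (all_freqs_equal tab)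
      + time (factorial K) + time (msort le tab) + time (search D K ys M ys)"
    using ys_Cons by (auto simp: LC_table_def K_def le_def[symmetric]
        ys_def[symmetric] simp del: search.simps)
  also have "\<dots> \<le> 1 + K + (length tab + 1) + (length tab + 1) + (K + 1)
      + time (msort le tab) + time (search D K ys M ys)"
    using time_all_freqs_equal[of tab] by (simp add: time_len time_factorial)
  finally have "real (time (LC_table D A tab)) \<le> real \<dots>" by (rule of_nat_mono)
  also have "\<dots> \<le> 4 + 2 * real K + 2 * l + (9 * l * ln l + l) + (l * (b + 1) + 1)"
    using search sort by (simp add: len l_def)
  also have "\<dots> = (2 * real K + 5) * 1 + 4 * l + (9 * ln l) * l + l\<^sup>2 * (real t + 13 * real K + 9 * ln l)"
    by (simp add: b_def power2_eq_square algebra_simps)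
  also have "\<dots> \<le> (2 * real K + 5) * l\<^sup>2 + 4 * l\<^sup>2 + (9 * ln l) * l\<^sup>2
      + l\<^sup>2 * (real t + 13 * real K + 9 * ln l)"
    using l by (intro add_mono mult_left_mono) (auto simp: self_le_power)
  also have "\<dots> = l\<^sup>2 * (real t + 15 * real K + 9 + 18 * ln l)"
    by (simp add: algebra_simps)
  also have "\<dots> \<le> l\<^sup>2 * (real t + 18 * real K + 18 * ln l)"
    using K by (intro mult_left_mono) auto
  finally show ?thesis by (simp add: K_def)
qed

lemma time_LC_table_le:
  assumes tab: "is_table \<pi> tab" and \<pi>: "set \<pi> \<subseteq> prefs A" and ne: "\<pi> \<noteq> []"
    and N: "card (set \<pi>) \<le> N"
  shows "real (time (LC_table D A tab)) \<le> (real N)\<^sup>2 * (real t + 18 * real (card A) + 18 * ln (real N))"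
proof -
  have l: "real (card (set \<pi>)) \<ge> 1" using ne by (simp add: Suc_le_eq card_gt_0_iff)
  have "real (time (LC_table D A tab)) \<le> (real (card (set \<pi>)))\<^sup>2 *
      (real t + 18 * real (card A) + 18 * ln (real (card (set \<pi>))))"
    by (rule time_LC_table[OF tab \<pi> ne])
  also have "\<dots> \<le> (real N)\<^sup>2 * (real t + 18 * real (card A) + 18 * ln (real N))"
    using N l by (intro mult_mono power_mono add_mono) auto
  finally show ?thesis .
qed

lemma time_LC:
  assumes \<pi>: "set \<pi> \<subseteq> prefs A" and ne: "\<pi> \<noteq> []"
  defines "n \<equiv> real (length \<pi>)"
  shows "real (time (LC D A \<pi>)) \<le> n\<^sup>2 * (2 * real t + 20 * real (card A) + 18 * ln n)"
proof -
  let ?tab = "val (frequencies D \<pi>)"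
  have n: "n \<ge> 1" using ne by (simp add: n_def Suc_le_eq)
  have K: "real (card A) \<ge> 3" using card by simp
  have table: "real (time (LC_table D A ?tab)) \<le> n\<^sup>2 * (real t + 18 * real (card A) + 18 * ln n)"
    unfolding n_def
    by (rule time_LC_table_le[OF is_table_frequencies[OF \<pi>] \<pi> ne card_length])
  have "real (time (frequencies D \<pi>)) \<le> real (length \<pi> * (2 + length \<pi> * (t + 1)) + 2)"
    using time_frequencies[OF \<pi>] by (rule of_nat_mono)
  also have "\<dots> = n\<^sup>2 * (real t + 1) + 2 * n + 2"
    by (simp add: n_def power2_eq_square algebra_simps)
  finally have "real (time (frequencies D \<pi>)) \<le> n\<^sup>2 * (real t + 1) + 2 * n + 2" .
  then have "1 + real (time (frequencies D \<pi>)) \<le> n\<^sup>2 * (real t + 1) + 2 * n + 3 * 1"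
    by simp
  also have "\<dots> \<le> n\<^sup>2 * (real t + 1) + 2 * n\<^sup>2 + 3 * n\<^sup>2"
    using n by (intro add_mono mult_left_mono) (auto simp: self_le_power)
  also have "\<dots> = n\<^sup>2 * (real t + 6)"
    by (simp add: algebra_simps)
  also have "\<dots> \<le> n\<^sup>2 * (real t + 2 * real (card A))"
    using K by (intro mult_left_mono) auto
  finally have "1 + real (time (frequencies D \<pi>)) \<le> n\<^sup>2 * (real t + 2 * real (card A))" .
  with table show ?thesis by (simp add: LC_def algebra_simps)
qed

lemma card_set_le:
  assumes "set \<pi> \<subseteq> prefs A"
  shows "card (set \<pi>) \<le> min (fact (card A)) (length \<pi>)"
  using card_mono[OF finite_prefs[OF finite] assms] card_prefs[OF finite] card_length by simp

end

lemma K_sqrt_ln_bounds: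
  assumes "K \<ge> (3 :: nat)"
  shows "real K \<le> real K * sqrt (ln (real K))" "real K * sqrt (ln (real K)) \<le> (real K)\<^sup>2"
proof -
  have "ln (real K) \<ge> 1"
    using assms exp_le by (subst ln_ge_iff) auto
  then have "sqrt (ln (real K)) \<ge> 1" by simp
  then show "real K \<le> real K * sqrt (ln (real K))"
    using mult_left_mono[of 1 "sqrt (ln (real K))" "real K"] by simp
  have "ln (real K) \<le> real K" using ln_le_minus_one[of "real K"] assms by simp
  also have "\<dots> \<le> (real K)\<^sup>2" using assms by (simp add: self_le_power)
  finally have "sqrt (ln (real K)) \<le> real K" by (simp add: real_le_lsqrt)
  then show "real K * sqrt (ln (real K)) \<le> (real K)\<^sup>2"
    by (simp add: power2_eq_square mult_left_mono)
qed

theorem theorem1: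
  fixes D :: "'a set \<Rightarrow> 'a rel \<Rightarrow> 'a rel \<Rightarrow> nat tm" and c :: real
  assumes D_correct: "\<And>A r s. finite A \<Longrightarrow> card A \<ge> 3 \<Longrightarrow> r \<in> prefs A \<Longrightarrow> s \<in> prefs A \<Longrightarrow>
      val (D A r s) = inv_dist A r s"
    and D_time: "\<And>A r s. finite A \<Longrightarrow> card A \<ge> 3 \<Longrightarrow> r \<in> prefs A \<Longrightarrow> s \<in> prefs A \<Longrightarrow>
      real (time (D A r s)) \<le> c * (real (card A) * sqrt (ln (real (card A))))"
  shows "(\<forall>A \<pi>. finite A \<and> card A \<ge> 3 \<and> set \<pi> \<subseteq> prefs A \<longrightarrow>
            (case val (LC (D A) A \<pi>) of
               None \<Rightarrow> \<not> level1 A \<pi>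
             | Some r0 \<Rightarrow> level1_around A \<pi> r0))
       \<and> (\<exists>C. \<forall>A \<pi>. finite A \<and> card A \<ge> 3 \<and> set \<pi> \<subseteq> prefs A \<and> \<pi> \<noteq> [] \<longrightarrow>
            real (time (LC_table (D A) A (val (frequencies (D A) \<pi>))))
              \<le> C * LC_bound (card A) (length \<pi>)
            \<and> (length \<pi> \<le> fact (card A) \<longrightarrow>
                 real (time (LC (D A) A \<pi>)) \<le> C * LC_bound (card A) (length \<pi>)))
       \<and> (\<exists>p :: nat poly. \<forall>A \<pi>. finite A \<and> card A \<ge> 3 \<and> set \<pi> \<subseteq> prefs A \<and> \<pi> \<noteq> [] \<longrightarrow>
            time (LC (D A) A \<pi>) \<le> poly p (length \<pi> * card A))"
proof -
  define W :: "'a set \<Rightarrow> real" where "W A = real (card A) * sqrt (ln (real (card A)))" for A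
  define t :: "'a set \<Rightarrow> nat" where "t A = nat \<lfloor>\<bar>c\<bar> * W A\<rfloor>" for A
  have W: "real (card A) \<le> W A" "W A \<le> (real (card A))\<^sup>2" if "card A \<ge> 3" for A :: "'a set"
    using K_sqrt_ln_bounds[OF that] by (simp_all add: W_def)
  have t: "real (t A) \<le> \<bar>c\<bar> * W A" if "card A \<ge> 3" for A
  proof -
    have "0 \<le> W A" using W(1)[OF that] by linarith
    then show ?thesis by (simp add: t_def)
  qed
  have loc: "distance_procedure A (D A) (t A)" if A: "finite A" "card A \<ge> 3" for A
  proof
    fix r s assume rs: "r \<in> prefs A" "s \<in> prefs A"
    show "val (D A r s) = inv_dist A r s" using D_correct A rs .
    have "0 \<le> W A" using W(1)[OF A(2)] by linarith
    then have "c * W A \<le> \<bar>c\<bar> * W A" by (rule mult_right_mono[OF abs_ge_self])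
    with D_time[OF A rs] have "real (time (D A r s)) \<le> \<bar>c\<bar> * W A"
      unfolding W_def by linarith
    then show "time (D A r s) \<le> t A" unfolding t_def by (rule le_nat_floor)
  qed (use A in auto)
  have correct: "\<forall>A \<pi>. finite A \<and> card A \<ge> 3 \<and> set \<pi> \<subseteq> prefs A \<longrightarrow>
      (case val (LC (D A) A \<pi>) of None \<Rightarrow> \<not> level1 A \<pi> | Some r0 \<Rightarrow> level1_around A \<pi> r0)"
    using distance_procedure.LC_correct[OF loc] by blast
  have bound: "N\<^sup>2 * (a * real (t A) + b * real (card A) + 18 * ln N) \<le>
      (a * \<bar>c\<bar> + b) * (N\<^sup>2 * W A + N\<^sup>2 * ln N)"
    if "card A \<ge> 3" "N \<ge> 1" "a \<ge> 0" "b \<ge> 18" for A and N a b :: real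
  proof -
    have "N\<^sup>2 * (a * real (t A) + b * real (card A) + 18 * ln N) \<le>
        N\<^sup>2 * (a * (\<bar>c\<bar> * W A) + b * W A + (a * \<bar>c\<bar> + b) * ln N)"
    proof (intro mult_left_mono add_mono)
      show "18 * ln N \<le> (a * \<bar>c\<bar> + b) * ln N"
        using that by (intro mult_right_mono) (simp_all add: add_increasing)
    qed (use t[OF that(1)] W(1)[OF that(1)] that in simp_all)
    then show ?thesis by (simp add: algebra_simps)
  qed
  define C where "C = 2 * \<bar>c\<bar> + 20"
  have time: "real (time (LC_table (D A) A (val (frequencies (D A) \<pi>)))) \<le> C * LC_bound (card A) (length \<pi>)
      \<and> (length \<pi> \<le> fact (card A) \<longrightarrow> real (time (LC (D A) A \<pi>)) \<le> C * LC_bound (card A) (length \<pi>))"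
    if A: "finite A" "card A \<ge> 3" and \<pi>: "set \<pi> \<subseteq> prefs A" "\<pi> \<noteq> []" for A \<pi>
  proof -
    interpret distance_procedure A "D A" "t A" using loc A .
    define N where "N = min (fact (card A)) (length \<pi>)"
    have N: "real N \<ge> 1"
      using \<pi>(2) by (simp add: N_def Suc_le_eq fact_gt_zero)
    have LCb: "LC_bound (card A) (length \<pi>) = (real N)\<^sup>2 * W A + (real N)\<^sup>2 * ln (real N)"
      by (simp add: LC_bound_def N_def W_def Let_def)
    have nonneg: "0 \<le> LC_bound (card A) (length \<pi>)"
      unfolding LCb using N W(1)[OF A(2)] by (intro add_nonneg_nonneg mult_nonneg_nonneg) auto
    have "real (time (LC_table (D A) A (val (frequencies (D A) \<pi>)))) \<le>
        (real N)\<^sup>2 * (1 * real (t A) + 18 * real (card A) + 18 * ln (real N))"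
      using time_LC_table_le[OF is_table_frequencies[OF \<pi>(1)] \<pi> card_set_le[OF \<pi>(1)]]
      by (simp add: N_def)
    also have "\<dots> \<le> (1 * \<bar>c\<bar> + 18) * LC_bound (card A) (length \<pi>)"
      unfolding LCb by (rule bound) (use A N in auto)
    also have "\<dots> \<le> C * LC_bound (card A) (length \<pi>)"
      using nonneg by (intro mult_right_mono) (auto simp: C_def)
    finally have table: "real (time (LC_table (D A) A (val (frequencies (D A) \<pi>)))) \<le>
        C * LC_bound (card A) (length \<pi>)" .
    have "real (time (LC (D A) A \<pi>)) \<le> C * LC_bound (card A) (length \<pi>)" if "length \<pi> \<le> fact (card A)"
    proof -
      have "N = length \<pi>" using that by (simp add: N_def)
      then have "real (time (LC (D A) A \<pi>)) \<le>
          (real N)\<^sup>2 * (2 * real (t A) + 20 * real (card A) + 18 * ln (real N))"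
        using time_LC[OF \<pi>] by simp
      also have "\<dots> \<le> C * LC_bound (card A) (length \<pi>)"
        unfolding LCb C_def by (rule bound) (use A N in auto)
      finally show ?thesis .
    qed
    with table show ?thesis by blast
  qed
  define m where "m = nat \<lceil>2 * \<bar>c\<bar> + 38\<rceil>"
  have poly: "time (LC (D A) A \<pi>) \<le> poly (monom m 3) (length \<pi> * card A)"
    if A: "finite A" "card A \<ge> 3" and \<pi>: "set \<pi> \<subseteq> prefs A" "\<pi> \<noteq> []" for A \<pi>
  proof -
    interpret distance_procedure A "D A" "t A" using loc A .
    define n where "n = real (length \<pi>)"
    define K where "K = real (card A)"
    have n: "n \<ge> 1" using \<pi>(2) by (simp add: n_def Suc_le_eq)
    have K: "K \<ge> 1" using A(2) by (simp add: K_def)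
    have "real (time (LC (D A) A \<pi>)) \<le> n\<^sup>2 * (2 * real (t A) + 20 * K + 18 * ln n)"
      using time_LC[OF \<pi>] by (simp add: n_def K_def)
    also have "\<dots> \<le> n\<^sup>2 * ((2 * \<bar>c\<bar>) * (n * K ^ 3) + 20 * (n * K ^ 3) + 18 * (n * K ^ 3))"
    proof -
      have nK: "x * y \<le> n * K ^ 3" if "x \<le> n" "y \<le> K ^ 3" "0 \<le> y" for x y
        using that n by (intro mult_mono) auto
      have "K\<^sup>2 \<le> K ^ 3" using K by (intro power_increasing) auto
      then have "K\<^sup>2 \<le> n * K ^ 3" using nK[of 1 "K\<^sup>2"] n by simp
      then have "W A \<le> n * K ^ 3" using W(2)[OF A(2)] by (simp add: K_def)
      then have "\<bar>c\<bar> * W A \<le> \<bar>c\<bar> * (n * K ^ 3)" by (intro mult_left_mono) auto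
      then have "2 * real (t A) \<le> (2 * \<bar>c\<bar>) * (n * K ^ 3)" using t[OF A(2)] by simp
      moreover have "K \<le> n * K ^ 3" using nK[of 1 K] n K by (simp add: self_le_power)
      moreover have "ln n \<le> n * K ^ 3"
        using nK[of "ln n" 1] n K ln_le_minus_one[of n] by simp
      ultimately show ?thesis by (intro mult_left_mono) auto
    qed
    also have "\<dots> = (2 * \<bar>c\<bar> + 38) * (n * K) ^ 3"
      by (simp add: power_mult_distrib algebra_simps power2_eq_square power3_eq_cube)
    also have "\<dots> \<le> real m * (n * K) ^ 3"
      using n K by (intro mult_right_mono) (auto simp: m_def)
    also have "\<dots> = real (poly (monom m 3) (length \<pi> * card A))"
      by (simp add: poly_monom n_def K_def)
    finally show ?thesis by (simp only: of_nat_le_iff)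
  qed
  show ?thesis
    using correct time poly by blast
qed

end
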